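(* Let $(\Gamma,\mathbf{q})$ be the polarized metrized graph with $\mathbf{q}=0$ where $\Gamma$ is the tetrahedral graph: four vertices $P,Q,R,S$ and six edges $PQ,PR,PS,QR,QS,RS$ of lengths $a,b,c,d,e,f>0$ respectively (so the pairs of opposite edges have lengths $\{a,f\},\{b,e\},\{c,d\}$). Then $\bar g(\Gamma)=3$, $\ell(\Gamma)=a+b+c+d+e+f$, $\delta_0(\Gamma)=\ell(\Gamma)$, $\delta_1(\Gamma)=0$. Moreover, with $$A=abcd+abce+abde+acde+abcf+abdf+bcdf+acef+bcef+adef+bdef+cdef,$$ $$B=bcde+acdf+abef,$$ $$C=abd+acd+bcd+abe+ace+bce+bde+cde+abf+acf+bcf+adf+cdf+aef+bef+def,$$ one has $$\tau(\Gamma)=\frac{\ell(\Gamma)}{12}-\frac{A+2B}{6C},\qquad \theta(\Gamma)=\frac{6A+8B}{C},\qquad \varphi(\Gamma)=\frac{\ell(\Gamma)}{9}-\frac{2A+7B}{9C},$$ $$\lambda(\Gamma)=\frac{3\,\ell(\Gamma)}{28}+\frac{A}{28C},\qquad \epsilon(\Gamma)=\frac29\ell(\Gamma)+\frac{5A+4B}{9C}.$$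
   Context: A metrized graph $\Gamma$ is a finite connected graph in which each edge $e_i$ is identified with a segment of positive length $L_i$; $\upsilon(p)$ is the number of directions emanating from $p\in\Gamma$; $V(\Gamma)$ is the vertex set; $\ell(\Gamma)=\sum_i L_i$; $g(\Gamma)=e-v+1$ is the first Betti number ($e$ edges, $v$ vertices). For $\mathbf{q}:\Gamma\to\mathbb{N}=\{0,1,2,\dots\}$ supported on vertices, the canonical divisor is $K=\sum_{p\in V(\Gamma)}(\upsilon(p)-2+2\mathbf{q}(p))\,p$; $(\Gamma,\mathbf{q})$ is a polarized metrized graph if all coefficients of $K$ are $\ge0$, and its genus is $\bar g=\bar g(\Gamma)=g(\Gamma)+\sum_p\mathbf{q}(p)$. $r(x,y)$ is the resistance function: the effective resistance between $x$ and $y$ when $\Gamma$ is viewed as an electrical circuit in which a segment of length $L$ is a resistor of resistance $L$. The tau constant is $\tau(\Gamma)=\frac14\int_\Gamma\big(\frac{\partial}{\partial x}r(x,y)\big)^2dx$ (independent of the fixed $y\in\Gamma$), and $$\theta(\Gamma)=\sum_{p,q\in V(\Gamma)}(\upsilon(p)-2+2\mathbf{q}(p))(\upsilon(q)-2+2\mathbf{q}(q))\,r(p,q)$$ (sum over ordered pairs). Let $\delta_K=\sum_p(\upsilon(p)-2+2\mathbf{q}(p))\delta_p$, with $\delta_p$ the Dirac measure at $p$. The admissible measure associated to $K$ (Zhang) is $$\mu_{ad}=\frac1{\bar g}\Big(\sum_{p\in V(\Gamma)}\mathbf{q}(p)\delta_p+\sum_{e_i}\frac{dx|_{e_i}}{L_i+R_i}\Big),$$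 where $R_i$ is the effective resistance between the end points of $e_i$ in the graph obtained by deleting the interior of $e_i$ ($R_i=\infty$ for a bridge). The invariants are $$\epsilon(\Gamma)=\iint_{\Gamma\times\Gamma} r(x,y)\,\delta_K(x)\,\mu_{ad}(y),\qquad Z(\Gamma)=\frac12\iint_{\Gamma\times\Gamma} r(x,y)\,\mu_{ad}(x)\,\mu_{ad}(y),$$ $$\varphi(\Gamma)=3\bar g\,Z(\Gamma)-\frac14\big(\epsilon(\Gamma)+\ell(\Gamma)\big),\qquad \lambda(\Gamma)=\frac{\bar g-1}{6(2\bar g+1)}\varphi(\Gamma)+\frac1{12}\big(\epsilon(\Gamma)+\ell(\Gamma)\big).$$ For $p\in\Gamma\setminus V(\Gamma)$, let $\Gamma\text{-}p$ be obtained by cutting $\Gamma$ at $p$ (removing $p$ and adding two end points to close the remaining parts). The point $p$ is of type $0$ if $\Gamma\text{-}p$ is connected; otherwise $\Gamma\text{-}p$ is a union of two polarized subgraphs (with $\mathbf{q}$ restricted and equal to $0$ at the new end points) of genera $i$ and $\bar g-i$ with $0<i\le\bar g/2$, and $p$ is of type $i$. $\delta_i(\Gamma)$ is the total length of the set of points of type $i$ (for $\bar g=3$ only $i=0,1$ occur). *)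

theory Defs
  imports "HOL-Analysis.Analysis" "Graph_Theory.Digraph_Component"
begin

section \<open>Metrized graphs\<close>

text \<open>
  A metrized graph is given by a finite connected multigraph \<open>G\<close> (loops and parallel edges are
  allowed) together with a length \<open>L e > 0\<close> for each edge \<open>e\<close>. The underlying graph is a library
  digraph: the direction of an arc only parametrizes the segment, so that \<open>Interior e t\<close> is the point
  of \<open>e\<close> at distance \<open>t\<close> from \<open>tail G e\<close>. The constant \<open>Digraph_Component.connected\<close> refers to the
  underlying undirected graph.
\<close>

definition metrized_graph :: "('v, 'e) pre_digraph \<Rightarrow> ('e \<Rightarrow> real) \<Rightarrow> bool" where
  "metrized_graph G L \<longleftrightarrow>
     fin_digraph G \<and> Digraph_Component.connected G \<and> (\<forall>e\<in>arcs G. 0 < L e)"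

datatype ('v, 'e) point = Vertex 'v | Interior 'e real

definition points :: "('v, 'e) pre_digraph \<Rightarrow> ('e \<Rightarrow> real) \<Rightarrow> ('v, 'e) point set" where
  "points G L = Vertex ` verts G \<union> {Interior e t |e t. e \<in> arcs G \<and> 0 < t \<and> t < L e}"

definition total_length :: "('v, 'e) pre_digraph \<Rightarrow> ('e \<Rightarrow> real) \<Rightarrow> real" where
  "total_length G L = (\<Sum>e\<in>arcs G. L e)"

text \<open>A loop contributes two directions at its vertex.\<close>

definition valence :: "('v, 'e) pre_digraph \<Rightarrow> 'v \<Rightarrow> nat" where
  "valence G p = out_degree G p + in_degree G p"

definition betti :: "('v, 'e) pre_digraph \<Rightarrow> int" where
  "betti G = int (card (arcs G)) - int (card (verts G)) + 1"

text \<open>Since \<open>\<^bold>q\<close> is supported on the vertices, it is represented by its values there.\<close>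

definition genus :: "('v, 'e) pre_digraph \<Rightarrow> ('v \<Rightarrow> nat) \<Rightarrow> int" where
  "genus G q = betti G + int (\<Sum>p\<in>verts G. q p)"

definition canonical_coeff :: "('v, 'e) pre_digraph \<Rightarrow> ('v \<Rightarrow> nat) \<Rightarrow> 'v \<Rightarrow> int" where
  "canonical_coeff G q p = int (valence G p) - 2 + 2 * int (q p)"

definition polarized_metrized_graph ::
    "('v, 'e) pre_digraph \<Rightarrow> ('e \<Rightarrow> real) \<Rightarrow> ('v \<Rightarrow> nat) \<Rightarrow> bool" where
  "polarized_metrized_graph G L q \<longleftrightarrow>
     metrized_graph G L \<and> (\<forall>p\<in>verts G. 0 \<le> canonical_coeff G q p)"


section \<open>Effective resistance\<close>

text \<open>
  In a network with resistance \<open>R e\<close> on each edge \<open>e\<close>, the potential \<open>u\<close> and the current \<open>i\<close> (signed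
  along the direction of the arcs) describe a unit current entering at \<open>x\<close> and leaving at \<open>y\<close>:
  Ohm's law and Kirchhoff's current law.
\<close>

definition unit_current ::
    "('v, 'e) pre_digraph \<Rightarrow> ('e \<Rightarrow> real) \<Rightarrow> 'v \<Rightarrow> 'v \<Rightarrow> ('v \<Rightarrow> real) \<Rightarrow> ('e \<Rightarrow> real) \<Rightarrow> bool" where
  "unit_current G R x y u i \<longleftrightarrow>
     (\<forall>e\<in>arcs G. u (tail G e) - u (head G e) = R e * i e) \<and>
     (\<forall>v\<in>verts G. (\<Sum>e\<in>out_arcs G v. i e) - (\<Sum>e\<in>in_arcs G v. i e) =
        (if v = x then 1 else 0) - (if v = y then 1 else 0))"

definition effective_resistance ::
    "('v, 'e) pre_digraph \<Rightarrow> ('e \<Rightarrow> real) \<Rightarrow> 'v \<Rightarrow> 'v \<Rightarrow> real" where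
  "effective_resistance G R x y = (THE \<rho>. \<exists>u i. unit_current G R x y u i \<and> \<rho> = u x - u y)"

text \<open>
  For points inside the edges, these points are first made vertices: the edges of the subdivision of
  \<open>(G, L)\<close> at the points of \<open>X\<close> are the triples \<open>(e, s, t)\<close> such that \<open>s < t\<close> are consecutive division
  points of the edge \<open>e\<close>, identified with \<open>[0, L e]\<close>.
\<close>

definition edge_point ::
    "('v, 'e) pre_digraph \<Rightarrow> ('e \<Rightarrow> real) \<Rightarrow> 'e \<Rightarrow> real \<Rightarrow> ('v, 'e) point" where
  "edge_point G L e s =
     (if s = 0 then Vertex (tail G e) else if s = L e then Vertex (head G e) else Interior e s)"

definition division_points :: "('e \<Rightarrow> real) \<Rightarrow> ('v, 'e) point set \<Rightarrow> 'e \<Rightarrow> real set" where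
  "division_points L X e = {0, L e} \<union> {t. 0 < t \<and> t < L e \<and> Interior e t \<in> X}"

definition subdivision ::
    "('v, 'e) pre_digraph \<Rightarrow> ('e \<Rightarrow> real) \<Rightarrow> ('v, 'e) point set \<Rightarrow>
     (('v, 'e) point, 'e \<times> real \<times> real) pre_digraph" where
  "subdivision G L X =
     \<lparr> verts = Vertex ` verts G \<union> (X \<inter> points G L),
       arcs = {(e, s, t). e \<in> arcs G \<and> s \<in> division_points L X e \<and> t \<in> division_points L X e \<and>
                 s < t \<and> division_points L X e \<inter> {s<..<t} = {}},
       tail = (\<lambda>(e, s, t). edge_point G L e s),
       head = (\<lambda>(e, s, t). edge_point G L e t) \<rparr>"

definition resistance ::
    "('v, 'e) pre_digraph \<Rightarrow> ('e \<Rightarrow> real) \<Rightarrow> ('v, 'e) point \<Rightarrow> ('v, 'e) point \<Rightarrow> real" where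
  "resistance G L x y = effective_resistance (subdivision G L {x, y}) (\<lambda>(e, s, t). t - s) x y"

definition deletion_resistance :: "('v, 'e) pre_digraph \<Rightarrow> ('e \<Rightarrow> real) \<Rightarrow> 'e \<Rightarrow> ennreal" where
  "deletion_resistance G L e =
     (let G' = pre_digraph.del_arc G e
      in if Digraph_Component.connected G'
         then ennreal (resistance G' L (Vertex (tail G e)) (Vertex (head G e)))
         else \<infinity>)"


section \<open>Measures on a metrized graph\<close>

text \<open>
  \<open>graph_measure G L m c\<close> is the measure \<open>\<Sum>p. m p \<delta>\<^sub>p + \<Sum>e. c e dx|\<^sub>e\<close> on the Borel sets of the
  metrized graph, i.e. the sets whose intersection with each open edge is Borel in the coordinate
  of that edge.
\<close>

definition graph_sets ::
    "('v, 'e) pre_digraph \<Rightarrow> ('e \<Rightarrow> real) \<Rightarrow> ('v, 'e) point set set" where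
  "graph_sets G L =
     {A. A \<subseteq> points G L \<and> (\<forall>e\<in>arcs G. {t \<in> {0<..<L e}. Interior e t \<in> A} \<in> sets borel)}"

definition graph_measure ::
    "('v, 'e) pre_digraph \<Rightarrow> ('e \<Rightarrow> real) \<Rightarrow> ('v \<Rightarrow> ennreal) \<Rightarrow> ('e \<Rightarrow> ennreal) \<Rightarrow>
     ('v, 'e) point measure" where
  "graph_measure G L m c = measure_of (points G L) (graph_sets G L)
     (\<lambda>A. (\<Sum>p\<in>verts G. m p * indicator A (Vertex p)) +
          (\<Sum>e\<in>arcs G. c e * emeasure lborel {t \<in> {0<..<L e}. Interior e t \<in> A}))"

lemma sigma_algebra_graph_sets: "sigma_algebra (points G L) (graph_sets G L)"
proof (rule sigma_algebra_iff2[THEN iffD2], intro conjI ballI allI impI)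
  show "graph_sets G L \<subseteq> Pow (points G L)" "{} \<in> graph_sets G L"
    by (auto simp: graph_sets_def)
next
  fix A assume A: "A \<in> graph_sets G L"
  have "{t \<in> {0<..<L e}. Interior e t \<in> points G L - A} =
      {0<..<L e} - {t \<in> {0<..<L e}. Interior e t \<in> A}" if "e \<in> arcs G" for e
    using that by (auto simp: points_def)
  then show "points G L - A \<in> graph_sets G L"
    using A by (auto simp: graph_sets_def)
next
  fix A :: "nat \<Rightarrow> ('a, 'b) point set" assume A: "range A \<subseteq> graph_sets G L"
  have "{t \<in> {0<..<L e}. Interior e t \<in> \<Union> (range A)} =
      (\<Union>n. {t \<in> {0<..<L e}. Interior e t \<in> A n})" for e
    by auto
  then show "\<Union> (range A) \<in> graph_sets G L"
    using A by (fastforce simp: graph_sets_def)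
qed

lemma space_graph_measure: "space (graph_measure G L m c) = points G L"
  unfolding graph_measure_def by (rule space_measure_of) (auto simp: graph_sets_def)

lemma sets_graph_measure: "sets (graph_measure G L m c) = graph_sets G L"
  unfolding graph_measure_def
  by (rule sigma_algebra.sets_measure_of_eq[OF sigma_algebra_graph_sets])

lemma emeasure_graph_measure:
  assumes "A \<in> graph_sets G L"
  shows "emeasure (graph_measure G L m c) A =
     (\<Sum>p\<in>verts G. m p * indicator A (Vertex p)) +
     (\<Sum>e\<in>arcs G. c e * emeasure lborel {t \<in> {0<..<L e}. Interior e t \<in> A})"
    (is "_ = ?\<mu> A")
proof (rule emeasure_measure_of_sigma[of "points G L" "graph_sets G L" ?\<mu> A,
      folded graph_measure_def])
  show "positive (graph_sets G L) ?\<mu>"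
    by (simp add: positive_def)
  show "countably_additive (graph_sets G L) ?\<mu>"
  proof (rule countably_additiveI)
    fix A :: "nat \<Rightarrow> ('a, 'b) point set"
    assume A: "range A \<subseteq> graph_sets G L" and dis: "disjoint_family A"
    have P: "(\<Sum>n. m p * indicator (A n) (Vertex p)) = m p * indicator (\<Union>n. A n) (Vertex p)" for p
      by (simp add: suminf_indicator[OF dis])
    have E: "(\<Sum>n. c e * emeasure lborel {t \<in> {0<..<L e}. Interior e t \<in> A n}) =
        c e * emeasure lborel {t \<in> {0<..<L e}. Interior e t \<in> (\<Union>n. A n)}"
      if e: "e \<in> arcs G" for e
    proof -
      have "(\<Sum>n. emeasure lborel {t \<in> {0<..<L e}. Interior e t \<in> A n}) =
          emeasure lborel (\<Union>n. {t \<in> {0<..<L e}. Interior e t \<in> A n})"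
      proof (rule suminf_emeasure)
        show "range (\<lambda>n. {t \<in> {0<..<L e}. Interior e t \<in> A n}) \<subseteq> sets lborel"
          using A e by (auto simp: graph_sets_def)
        show "disjoint_family (\<lambda>n. {t \<in> {0<..<L e}. Interior e t \<in> A n})"
          using dis by (fastforce simp: disjoint_family_on_def)
      qed
      also have "(\<Union>n. {t \<in> {0<..<L e}. Interior e t \<in> A n}) =
          {t \<in> {0<..<L e}. Interior e t \<in> (\<Union>n. A n)}"
        by auto
      finally show ?thesis by simp
    qed
    have "(\<Sum>n. ?\<mu> (A n)) =
        (\<Sum>p\<in>verts G. \<Sum>n. m p * indicator (A n) (Vertex p)) +
        (\<Sum>e\<in>arcs G. \<Sum>n. c e * emeasure lborel {t \<in> {0<..<L e}. Interior e t \<in> A n})"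
      by (simp only: suminf_add[symmetric] suminf_sum summableI)
    also have "\<dots> = ?\<mu> (\<Union>n. A n)"
      unfolding P using E by (intro arg_cong2[where f = "(+)"] sum.cong refl) auto
    finally show "(\<Sum>n. ?\<mu> (A n)) = ?\<mu> (\<Union>n. A n)" .
  qed
qed (use assms sigma_algebra_graph_sets in auto)

definition length_measure ::
    "('v, 'e) pre_digraph \<Rightarrow> ('e \<Rightarrow> real) \<Rightarrow> ('v, 'e) point measure" where
  "length_measure G L = graph_measure G L (\<lambda>_. 0) (\<lambda>_. 1)"

text \<open>The measure \<open>\<delta>\<^sub>K\<close>; its masses are nonnegative when the graph is polarized.\<close>

definition canonical_measure ::
    "('v, 'e) pre_digraph \<Rightarrow> ('e \<Rightarrow> real) \<Rightarrow> ('v \<Rightarrow> nat) \<Rightarrow> ('v, 'e) point measure" where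
  "canonical_measure G L q =
     graph_measure G L (\<lambda>p. ennreal (real_of_int (canonical_coeff G q p))) (\<lambda>_. 0)"

text \<open>Division in \<open>ennreal\<close>, so that bridges get density \<open>1 / \<infinity> = 0\<close>.\<close>

definition admissible_measure ::
    "('v, 'e) pre_digraph \<Rightarrow> ('e \<Rightarrow> real) \<Rightarrow> ('v \<Rightarrow> nat) \<Rightarrow> ('v, 'e) point measure" where
  "admissible_measure G L q =
     graph_measure G L
       (\<lambda>p. of_nat (q p) / ennreal (real_of_int (genus G q)))
       (\<lambda>e. 1 / (ennreal (L e) + deletion_resistance G L e) / ennreal (real_of_int (genus G q)))"


section \<open>Invariants\<close>

text \<open>The derivative along the edges; the value at the vertices, a null set, is immaterial.\<close>

fun edge_deriv :: "(('v, 'e) point \<Rightarrow> real) \<Rightarrow> ('v, 'e) point \<Rightarrow> real" where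
  "edge_deriv f (Interior e t) = deriv (\<lambda>s. f (Interior e s)) t"
| "edge_deriv f (Vertex p) = 0"

definition tau_const ::
    "('v, 'e) pre_digraph \<Rightarrow> ('e \<Rightarrow> real) \<Rightarrow> ('v, 'e) point \<Rightarrow> real" where
  "tau_const G L y =
     1/4 * (LINT x|length_measure G L. (edge_deriv (\<lambda>z. resistance G L z y) x)\<^sup>2)"

definition theta_inv :: "('v, 'e) pre_digraph \<Rightarrow> ('e \<Rightarrow> real) \<Rightarrow> ('v \<Rightarrow> nat) \<Rightarrow> real" where
  "theta_inv G L q =
     (\<Sum>p\<in>verts G. \<Sum>p'\<in>verts G.
        real_of_int (canonical_coeff G q p) * real_of_int (canonical_coeff G q p') *
        resistance G L (Vertex p) (Vertex p'))"

definition epsilon_inv :: "('v, 'e) pre_digraph \<Rightarrow> ('e \<Rightarrow> real) \<Rightarrow> ('v \<Rightarrow> nat) \<Rightarrow> real" where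
  "epsilon_inv G L q =
     (LINT y|admissible_measure G L q. LINT x|canonical_measure G L q. resistance G L x y)"

definition Z_inv :: "('v, 'e) pre_digraph \<Rightarrow> ('e \<Rightarrow> real) \<Rightarrow> ('v \<Rightarrow> nat) \<Rightarrow> real" where
  "Z_inv G L q =
     1/2 * (LINT y|admissible_measure G L q. LINT x|admissible_measure G L q. resistance G L x y)"

definition phi_inv :: "('v, 'e) pre_digraph \<Rightarrow> ('e \<Rightarrow> real) \<Rightarrow> ('v \<Rightarrow> nat) \<Rightarrow> real" where
  "phi_inv G L q =
     3 * real_of_int (genus G q) * Z_inv G L q - 1/4 * (epsilon_inv G L q + total_length G L)"

definition lambda_inv :: "('v, 'e) pre_digraph \<Rightarrow> ('e \<Rightarrow> real) \<Rightarrow> ('v \<Rightarrow> nat) \<Rightarrow> real" where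
  "lambda_inv G L q =
     (real_of_int (genus G q) - 1) / (6 * (2 * real_of_int (genus G q) + 1)) * phi_inv G L q +
     1/12 * (epsilon_inv G L q + total_length G L)"


section \<open>Types of points\<close>

text \<open>
  Cutting at a point inside the edge \<open>e\<close> replaces \<open>e\<close> by \<open>Inr False\<close>, from \<open>tail G e\<close> to the new end
  point \<open>Inr False\<close>, and \<open>Inr True\<close>, from the new end point \<open>Inr True\<close> to \<open>head G e\<close>. The lengths of
  the two pieces play no role for the genera, so only the combinatorial graph is recorded.
\<close>

definition cut_graph ::
    "('v, 'e) pre_digraph \<Rightarrow> 'e \<Rightarrow> ('v + bool, 'e + bool) pre_digraph" where
  "cut_graph G e =
     \<lparr> verts = Inl ` verts G \<union> range Inr,
       arcs = Inl ` (arcs G - {e}) \<union> range Inr,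
       tail = case_sum (\<lambda>e'. Inl (tail G e')) (\<lambda>b. if b then Inr True else Inl (tail G e)),
       head = case_sum (\<lambda>e'. Inl (head G e')) (\<lambda>b. if b then Inl (head G e) else Inr False) \<rparr>"

definition cut_polarization :: "('v \<Rightarrow> nat) \<Rightarrow> 'v + bool \<Rightarrow> nat" where
  "cut_polarization q = case_sum q (\<lambda>_. 0)"

definition edge_type :: "('v, 'e) pre_digraph \<Rightarrow> ('v \<Rightarrow> nat) \<Rightarrow> 'e \<Rightarrow> nat \<Rightarrow> bool" where
  "edge_type G q e i \<longleftrightarrow>
     (let G' = cut_graph G e; q' = cut_polarization q
      in if Digraph_Component.connected G' then i = 0
         else 0 < i \<and> 2 * int i \<le> genus G q \<and>
           (\<exists>H1 H2. subgraph H1 G' \<and> subgraph H2 G' \<and>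
              Digraph_Component.connected H1 \<and> Digraph_Component.connected H2 \<and>
              verts H1 \<inter> verts H2 = {} \<and> Digraph_Component.union H1 H2 = G' \<and>
              genus H1 q' = int i \<and> genus H2 q' = genus G q - int i))"

definition type_points ::
    "('v, 'e) pre_digraph \<Rightarrow> ('e \<Rightarrow> real) \<Rightarrow> ('v \<Rightarrow> nat) \<Rightarrow> nat \<Rightarrow> ('v, 'e) point set" where
  "type_points G L q i =
     {Interior e t |e t. e \<in> arcs G \<and> 0 < t \<and> t < L e \<and> edge_type G q e i}"

definition delta_inv ::
    "('v, 'e) pre_digraph \<Rightarrow> ('e \<Rightarrow> real) \<Rightarrow> ('v \<Rightarrow> nat) \<Rightarrow> nat \<Rightarrow> real" where
  "delta_inv G L q i = measure (length_measure G L) (type_points G L q i)"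


section \<open>The tetrahedral graph\<close>

datatype tetra_vertex = VP | VQ | VR | VS

datatype tetra_edge = PQ | PR | PS | QR | QS | RS

fun tetra_tail :: "tetra_edge \<Rightarrow> tetra_vertex" where
  "tetra_tail PQ = VP" | "tetra_tail PR = VP" | "tetra_tail PS = VP"
| "tetra_tail QR = VQ" | "tetra_tail QS = VQ" | "tetra_tail RS = VR"

fun tetra_head :: "tetra_edge \<Rightarrow> tetra_vertex" where
  "tetra_head PQ = VQ" | "tetra_head PR = VR" | "tetra_head PS = VS"
| "tetra_head QR = VR" | "tetra_head QS = VS" | "tetra_head RS = VS"

definition tetrahedral_graph :: "(tetra_vertex, tetra_edge) pre_digraph" where
  "tetrahedral_graph = \<lparr> verts = UNIV, arcs = UNIV, tail = tetra_tail, head = tetra_head \<rparr>"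

fun tetra_length ::
    "real \<Rightarrow> real \<Rightarrow> real \<Rightarrow> real \<Rightarrow> real \<Rightarrow> real \<Rightarrow> tetra_edge \<Rightarrow> real" where
  "tetra_length a b c d e f PQ = a" | "tetra_length a b c d e f PR = b"
| "tetra_length a b c d e f PS = c" | "tetra_length a b c d e f QR = d"
| "tetra_length a b c d e f QS = e" | "tetra_length a b c d e f RS = f"

end

theory Submission
  imports Defs
begin

text \<open>
  The integrals that define the invariants are computed in closed form for an arbitrary polarized
  metrized graph without bridges, from the matrix \<open>r\<close> of resistances between its vertices. The tetrahedron
  enters only at the end, through its resistance matrix and one polynomial identity.

  The resistance between arbitrary points reduces to \<open>r\<close> because a charge in the interior of an edge
  acts on the other edges as a charge spread affinely over its end points. Hence \<open>r(x, y)\<close> is the biaffine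
  interpolation of \<open>r\<close>, plus a term \<open>\<kappa> s (L - s)\<close> for each of the two points, minus twice the Green
  function of the segment if both points lie on the same edge (\<open>resistance_eq\<close>). That this
  potential computes the effective resistance follows from the reciprocity law
  (\<open>effective_resistance_eq\<close>): every solution of Kirchhoff's equations yields the same value. Here
  \<open>\<kappa> = (L - r\<^sub>e) / L\<^sup>2\<close> for \<open>r\<^sub>e\<close> the resistance between the end points of the edge, which
  equals \<open>1 / (L + R)\<close> by \<open>resistance_del_arc\<close> and thus is the density of
  \<open>g \<mu>\<^sub>a\<^sub>d\<close> (\<open>admissible_density\<close>).

  Consequently the integrands are piecewise quadratic along every edge. Let \<open>c\<close> be the equilibrium
  masses on the vertices, for which \<open>\<Sum>w. c w r v w\<close> is a constant \<open>\<rho>\<close>, and let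
  \<open>E = \<Sum>e. \<kappa>\<^sup>2 L\<^sup>3\<close>. Summation by parts gives \<open>\<tau> = \<rho>/2 + E/12\<close> (\<open>tau_const_eq\<close>). The
  mass of \<open>\<mu>\<^sub>a\<^sub>d\<close> near a vertex is governed by \<open>K/2 + c\<close> (\<open>sum_kappa_ends\<close>), so that
  \<open>g \<epsilon> = \<theta>/2 + 4(g - 1)\<tau>\<close> and \<open>2g\<^sup>2 Z = \<theta>/4 + 2(2g - 1)\<tau>\<close>
  (\<open>epsilon_inv_eq\<close>, \<open>Z_inv_eq\<close>); \<open>\<phi>\<close> and \<open>\<lambda>\<close> are combinations of these.

  For the tetrahedron, Kirchhoff's spanning tree formula provides \<open>r\<close>, and it remains to evaluate
  \<open>\<tau>\<close> and \<open>\<theta>\<close>. Every edge can be deleted without disconnecting the graph, so all points are of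
  type \<open>0\<close>.
\<close>

section \<open>Reciprocity\<close>

lemma (in fin_digraph) sum_arcs_by_tail:
  "(\<Sum>v\<in>verts G. \<Sum>e\<in>out_arcs G v. f e) = (\<Sum>e\<in>arcs G. f e)"
  unfolding out_arcs_def by (rule sum.group) auto

lemma (in fin_digraph) sum_arcs_by_head:
  "(\<Sum>v\<in>verts G. \<Sum>e\<in>in_arcs G v. f e) = (\<Sum>e\<in>arcs G. f e)"
  unfolding in_arcs_def by (rule sum.group) auto

text \<open>
  Summation by parts: the discrete divergence is the adjoint of the difference operator.
\<close>
lemma (in fin_digraph) sum_arcs_difference:
  fixes f :: "'a \<Rightarrow> real" and i :: "'b \<Rightarrow> real"
  shows "(\<Sum>e\<in>arcs G. (f (tail G e) - f (head G e)) * i e) =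
    (\<Sum>v\<in>verts G. f v * ((\<Sum>e\<in>out_arcs G v. i e) - (\<Sum>e\<in>in_arcs G v. i e)))"
proof -
  have "(\<Sum>v\<in>verts G. f v * ((\<Sum>e\<in>out_arcs G v. i e) - (\<Sum>e\<in>in_arcs G v. i e))) =
      (\<Sum>v\<in>verts G. \<Sum>e\<in>out_arcs G v. f (tail G e) * i e) -
      (\<Sum>v\<in>verts G. \<Sum>e\<in>in_arcs G v. f (head G e) * i e)"
    by (simp add: right_diff_distrib sum_subtractf sum_distrib_left)
  then show ?thesis
    unfolding sum_arcs_by_tail sum_arcs_by_head by (simp add: left_diff_distrib sum_subtractf)
qed

lemma (in fin_digraph) unit_current_pairing:
  assumes "x \<in> verts G" "y \<in> verts G" and ui: "unit_current G R x y u i"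
  shows "(\<Sum>e\<in>arcs G. (f (tail G e) - f (head G e)) * i e) = f x - f y"
proof -
  have "(\<Sum>e\<in>arcs G. (f (tail G e) - f (head G e)) * i e) =
      (\<Sum>v\<in>verts G. f v * ((if v = x then 1 else 0) - (if v = y then 1 else 0)))"
    unfolding sum_arcs_difference using ui by (simp add: unit_current_def)
  also have "\<dots> = (\<Sum>v\<in>verts G. (if v = x then f v else 0) - (if v = y then f v else 0))"
    by (rule sum.cong) auto
  also have "\<dots> = f x - f y"
    using assms by (simp add: sum_subtractf sum.delta)
  finally show ?thesis .
qed

text \<open>
  Any one solution of the circuit equations determines the effective resistance. Pairing two
  solutions \<open>(u, i)\<close> and \<open>(u', i')\<close> gives \<open>\<Sum>e. R e i e i' e\<close>, which is symmetric, so that both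
  potential differences agree.
\<close>
lemma (in fin_digraph) effective_resistance_eq:
  assumes xy: "x \<in> verts G" "y \<in> verts G" and ui: "unit_current G R x y u i"
  shows "effective_resistance G R x y = u x - u y"
  unfolding effective_resistance_def
proof (rule the_equality)
  show "\<exists>u' i'. unit_current G R x y u' i' \<and> u x - u y = u' x - u' y"
    using ui by blast
  fix \<rho> assume "\<exists>u' i'. unit_current G R x y u' i' \<and> \<rho> = u' x - u' y"
  then obtain u' i' where ui': "unit_current G R x y u' i'" and \<rho>: "\<rho> = u' x - u' y"
    by blast
  have "u' x - u' y = (\<Sum>e\<in>arcs G. (u' (tail G e) - u' (head G e)) * i e)"
    by (simp add: unit_current_pairing[OF xy ui])
  also have "\<dots> = (\<Sum>e\<in>arcs G. (u (tail G e) - u (head G e)) * i' e)"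
    using ui ui' by (intro sum.cong) (simp_all add: unit_current_def)
  also have "\<dots> = u x - u y"
    by (simp add: unit_current_pairing[OF xy ui'])
  finally show "\<rho> = u x - u y" using \<rho> by simp
qed

text \<open>
  The potential difference is the dissipated energy \<open>\<Sum>e. R e (i e)\<^sup>2\<close>.
\<close>
lemma (in fin_digraph) unit_current_potential_nonneg:
  assumes xy: "x \<in> verts G" "y \<in> verts G" and ui: "unit_current G R x y u i"
    and R: "\<And>e. e \<in> arcs G \<Longrightarrow> 0 \<le> R e"
  shows "0 \<le> u x - u y"
proof -
  have "u x - u y = (\<Sum>e\<in>arcs G. R e * i e * i e)"
    unfolding unit_current_pairing[OF xy ui, of u, symmetric]
    using ui by (intro sum.cong) (simp_all add: unit_current_def)
  also have "\<dots> \<ge> 0" using R by (intro sum_nonneg) (simp add: mult.assoc)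
  finally show ?thesis .
qed

section \<open>Subdivisions\<close>

locale metrized = fin_digraph +
  fixes L :: "'b \<Rightarrow> real"
  assumes length_pos: "e \<in> arcs G \<Longrightarrow> 0 < L e"
begin

lemma finite_division_points:
  fixes X :: "('a, 'b) point set"
  assumes "finite X"
  shows "finite (division_points L X e)"
proof -
  have "finite ((\<lambda>t. Interior e t :: ('a, 'b) point) -` X)"
    using assms by (intro finite_vimageI injI) auto
  then show ?thesis
    unfolding division_points_def by (auto elim: rev_finite_subset)
qed

lemma division_pointsD: "e \<in> arcs G \<Longrightarrow> s \<in> division_points L X e \<Longrightarrow> 0 \<le> s \<and> s \<le> L e"
  using length_pos by (force simp: division_points_def)

lemma edge_point_in_verts:
  "e \<in> arcs G \<Longrightarrow> s \<in> division_points L X e \<Longrightarrow> edge_point G L e s \<in> verts (subdivision G L X)"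
  by (auto simp: division_points_def edge_point_def subdivision_def points_def)

lemma in_arcs_subdivision: 
  "(e, s, t) \<in> arcs (subdivision G L X) \<longleftrightarrow> e \<in> arcs G \<and> s \<in> division_points L X e \<and>
     t \<in> division_points L X e \<and> s < t \<and> division_points L X e \<inter> {s<..<t} = {}"
  by (simp add: subdivision_def)

lemma tail_subdivision: "tail (subdivision G L X) (e, s, t) = edge_point G L e s"
  and head_subdivision: "head (subdivision G L X) (e, s, t) = edge_point G L e t"
  by (simp_all add: subdivision_def)

lemma fin_digraph_subdivision:
  assumes X: "finite X"
  shows "fin_digraph (subdivision G L X)"
proof
  fix a assume "a \<in> arcs (subdivision G L X)"
  then show "tail (subdivision G L X) a \<in> verts (subdivision G L X)"
    "head (subdivision G L X) a \<in> verts (subdivision G L X)"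
    by (cases a; auto simp: in_arcs_subdivision tail_subdivision head_subdivision
        intro!: edge_point_in_verts)+
next
  show "finite (verts (subdivision G L X))"
    using X by (simp add: subdivision_def)
  show "finite (arcs (subdivision G L X))"
  proof (rule finite_subset)
    show "arcs (subdivision G L X) \<subseteq>
        (SIGMA e:arcs G. division_points L X e \<times> division_points L X e)"
      by (auto simp: in_arcs_subdivision)
  qed (intro finite_SigmaI finite_arcs finite_division_points X)
qed

text \<open>
  An arc of the subdivision is determined by either of its end parameters. Sums over the arcs at a
  point of the subdivision thereby reduce to sums over the edges of the graph at that point.
\<close>
definition next_division :: "('a, 'b) point set \<Rightarrow> 'b \<Rightarrow> real \<Rightarrow> real" where
  "next_division X e s = Min {t \<in> division_points L X e. s < t}"

definition prev_division :: "('a, 'b) point set \<Rightarrow> 'b \<Rightarrow> real \<Rightarrow> real" where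
  "prev_division X e t = Max {s \<in> division_points L X e. s < t}"

lemma arc_iff_next:
  assumes X: "finite X"
  shows "(e, s, t) \<in> arcs (subdivision G L X) \<longleftrightarrow>
    e \<in> arcs G \<and> s \<in> division_points L X e \<and> s < L e \<and> t = next_division X e s"
proof -
  let ?D = "{t \<in> division_points L X e. s < t}"
  have fin: "finite ?D" using finite_division_points[OF X] by simp
  show ?thesis
  proof (cases "e \<in> arcs G \<and> s < L e")
    case True
    then have "L e \<in> ?D" by (simp add: division_points_def)
    then have eq: "t = Min ?D \<longleftrightarrow> t \<in> ?D \<and> (\<forall>t'\<in>?D. t \<le> t')"
      using fin by (metis (no_types, lifting) Min_eqI Min_in Min_le empty_iff)
    show ?thesis using True unfolding next_division_def eq in_arcs_subdivision by force
  next
    case False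
    then show ?thesis by (auto simp: in_arcs_subdivision dest: division_pointsD)
  qed
qed

lemma arc_iff_prev:
  assumes X: "finite X"
  shows "(e, s, t) \<in> arcs (subdivision G L X) \<longleftrightarrow>
    e \<in> arcs G \<and> t \<in> division_points L X e \<and> 0 < t \<and> s = prev_division X e t"
proof -
  let ?D = "{s \<in> division_points L X e. s < t}"
  have fin: "finite ?D" using finite_division_points[OF X] by simp
  show ?thesis
  proof (cases "e \<in> arcs G \<and> 0 < t")
    case True
    then have "0 \<in> ?D" by (simp add: division_points_def)
    then have eq: "s = Max ?D \<longleftrightarrow> s \<in> ?D \<and> (\<forall>s'\<in>?D. s' \<le> s)"
      using fin by (metis (no_types, lifting) Max_eqI Max_in Max_ge empty_iff)
    show ?thesis using True unfolding prev_division_def eq in_arcs_subdivision by force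
  next
    case False
    then show ?thesis by (auto simp: in_arcs_subdivision dest: division_pointsD)
  qed
qed

lemma edge_point_eq_Vertex:
  assumes "e \<in> arcs G"
  shows "edge_point G L e s = Vertex v \<longleftrightarrow> s = 0 \<and> tail G e = v \<or> s = L e \<and> head G e = v"
  using length_pos[OF assms] by (auto simp: edge_point_def)

lemma edge_point_eq_Interior:
  "0 < t \<Longrightarrow> t < L e' \<Longrightarrow> edge_point G L e s = Interior e' t \<longleftrightarrow> e = e' \<and> s = t"
  by (auto simp: edge_point_def)

lemma out_arcs_subdivision_Vertex:
  assumes X: "finite X"
  shows "out_arcs (subdivision G L X) (Vertex v) =
    (\<lambda>e. (e, 0, next_division X e 0)) ` out_arcs G v"
proof -
  have "(e, s, t) \<in> out_arcs (subdivision G L X) (Vertex v) \<longleftrightarrow>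
      e \<in> out_arcs G v \<and> s = 0 \<and> t = next_division X e 0" for e s t
    unfolding in_out_arcs_conv arc_iff_next[OF X] tail_subdivision
    by (auto simp: edge_point_eq_Vertex division_points_def dest: length_pos)
  then show ?thesis by (auto simp: image_iff)
qed

lemma in_arcs_subdivision_Vertex:
  assumes X: "finite X"
  shows "in_arcs (subdivision G L X) (Vertex v) =
    (\<lambda>e. (e, prev_division X e (L e), L e)) ` in_arcs G v"
proof -
  have "(e, s, t) \<in> in_arcs (subdivision G L X) (Vertex v) \<longleftrightarrow>
      e \<in> in_arcs G v \<and> s = prev_division X e (L e) \<and> t = L e" for e s t
    unfolding in_in_arcs_conv arc_iff_prev[OF X] head_subdivision
    by (auto simp: edge_point_eq_Vertex division_points_def dest: length_pos)
  then show ?thesis by (auto simp: image_iff)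
qed

lemma out_arcs_subdivision_Interior:
  assumes X: "finite X" and "Interior e s \<in> X \<inter> points G L"
  shows "out_arcs (subdivision G L X) (Interior e s) = {(e, s, next_division X e s)}"
proof -
  have "(e', s', t) \<in> out_arcs (subdivision G L X) (Interior e s) \<longleftrightarrow>
      (e', s', t) = (e, s, next_division X e s)" for e' s' t
    unfolding in_out_arcs_conv arc_iff_next[OF X] tail_subdivision
    using assms by (auto simp: edge_point_eq_Interior division_points_def points_def)
  then show ?thesis by auto
qed

lemma in_arcs_subdivision_Interior:
  assumes X: "finite X" and "Interior e t \<in> X \<inter> points G L"
  shows "in_arcs (subdivision G L X) (Interior e t) = {(e, prev_division X e t, t)}"
proof -
  have "(e', s, t') \<in> in_arcs (subdivision G L X) (Interior e t) \<longleftrightarrow>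
      (e', s, t') = (e, prev_division X e t, t)" for e' s t'
    unfolding in_in_arcs_conv arc_iff_prev[OF X] head_subdivision
    using assms by (auto simp: edge_point_eq_Interior division_points_def points_def)
  then show ?thesis by auto
qed

lemma sum_out_arcs_subdivision_Vertex:
  assumes X: "finite X"
    and f: "\<And>e s t. (e, s, t) \<in> arcs (subdivision G L X) \<Longrightarrow> f (e, s, t) = g e s"
  shows "(\<Sum>a\<in>out_arcs (subdivision G L X) (Vertex v). f a) = (\<Sum>e\<in>out_arcs G v. g e 0)"
proof -
  have "(e, 0, next_division X e 0) \<in> arcs (subdivision G L X)" if "e \<in> out_arcs G v" for e
    using that length_pos by (simp add: arc_iff_next[OF X] division_points_def)
  then have "f (e, 0, next_division X e 0) = g e 0" if "e \<in> out_arcs G v" for e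
    using f that by blast
  then show ?thesis
    unfolding out_arcs_subdivision_Vertex[OF X]
    by (subst sum.reindex) (auto simp: inj_on_def)
qed

lemma sum_in_arcs_subdivision_Vertex:
  assumes X: "finite X"
    and f: "\<And>e s t. (e, s, t) \<in> arcs (subdivision G L X) \<Longrightarrow> f (e, s, t) = g e t"
  shows "(\<Sum>a\<in>in_arcs (subdivision G L X) (Vertex v). f a) = (\<Sum>e\<in>in_arcs G v. g e (L e))"
proof -
  have "(e, prev_division X e (L e), L e) \<in> arcs (subdivision G L X)" if "e \<in> in_arcs G v" for e
    using that length_pos by (simp add: arc_iff_prev[OF X] division_points_def)
  then have "f (e, prev_division X e (L e), L e) = g e (L e)" if "e \<in> in_arcs G v" for e
    using f that by blast
  then show ?thesis
    unfolding in_arcs_subdivision_Vertex[OF X]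
    by (subst sum.reindex) (auto simp: inj_on_def)
qed

lemma sum_out_arcs_subdivision_Interior:
  assumes X: "finite X" and x: "Interior e s \<in> X \<inter> points G L"
    and f: "\<And>e s t. (e, s, t) \<in> arcs (subdivision G L X) \<Longrightarrow> f (e, s, t) = g e s"
  shows "(\<Sum>a\<in>out_arcs (subdivision G L X) (Interior e s). f a) = g e s"
proof -
  have "(e, s, next_division X e s) \<in> arcs (subdivision G L X)"
    using x by (auto simp add: arc_iff_next[OF X] division_points_def points_def)
  then show ?thesis
    unfolding out_arcs_subdivision_Interior[OF X x] by (simp add: f)
qed

lemma sum_in_arcs_subdivision_Interior:
  assumes X: "finite X" and x: "Interior e t \<in> X \<inter> points G L"
    and f: "\<And>e s t. (e, s, t) \<in> arcs (subdivision G L X) \<Longrightarrow> f (e, s, t) = g e t"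
  shows "(\<Sum>a\<in>in_arcs (subdivision G L X) (Interior e t). f a) = g e t"
proof -
  have "(e, prev_division X e t, t) \<in> arcs (subdivision G L X)"
    using x by (auto simp add: arc_iff_prev[OF X] division_points_def points_def)
  then show ?thesis
    unfolding in_arcs_subdivision_Interior[OF X x] by (simp add: f)
qed

end

section \<open>The resistance function of a metrized graph\<close>

fun interpolate :: "('v, 'e) pre_digraph \<Rightarrow> ('e \<Rightarrow> real) \<Rightarrow> ('v \<Rightarrow> real) \<Rightarrow> ('v, 'e) point \<Rightarrow> real" where
  "interpolate G L f (Vertex v) = f v"
| "interpolate G L f (Interior e s) = (1 - s / L e) * f (tail G e) + s / L e * f (head G e)"

text \<open>
  The Green function of the disjoint union of the edges, regarded as segments with grounded end
  points.
\<close>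
fun segment_green :: "('e \<Rightarrow> real) \<Rightarrow> ('v, 'e) point \<Rightarrow> ('v, 'e) point \<Rightarrow> real" where
  "segment_green L (Interior e s) (Interior e' t) =
     (if e = e' then min s t * (L e - max s t) / L e else 0)"
| "segment_green L (Vertex p) y = 0"
| "segment_green L x (Vertex p) = 0"

definition laplacian :: "('v, 'e) pre_digraph \<Rightarrow> ('e \<Rightarrow> real) \<Rightarrow> ('v \<Rightarrow> real) \<Rightarrow> 'v \<Rightarrow> real" where
  "laplacian G L f p =
     (\<Sum>e\<in>out_arcs G p. (f (tail G e) - f (head G e)) / L e) -
     (\<Sum>e\<in>in_arcs G p. (f (tail G e) - f (head G e)) / L e)"

lemma interpolate_swap:
  "interpolate G L (\<lambda>v. interpolate G L (\<lambda>w. f v w) y) x =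
   interpolate G L (\<lambda>w. interpolate G L (\<lambda>v. f v w) x) y"
proof (cases x; cases y)
  fix e s e' s' assume "x = Interior e s" "y = Interior e' s'"
  moreover have "(1 - \<sigma>) * ((1 - \<tau>) * a + \<tau> * b) + \<sigma> * ((1 - \<tau>) * a' + \<tau> * b') =
      (1 - \<tau>) * ((1 - \<sigma>) * a + \<sigma> * a') + \<tau> * ((1 - \<sigma>) * b + \<sigma> * b')"
    for \<sigma> \<tau> a b a' b' :: real by algebra
  ultimately show ?thesis by (simp only: interpolate.simps)
qed simp_all

lemma interpolate_linear:
  "interpolate G L (\<lambda>v. f v + g v) x = interpolate G L f x + interpolate G L g x"
  "interpolate G L (\<lambda>v. f v - g v) x = interpolate G L f x - interpolate G L g x"
  "interpolate G L (\<lambda>v. k * f v) x = k * interpolate G L f x"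
  "interpolate G L (\<lambda>v. f v * k) x = interpolate G L f x * k"
  by (cases x; simp add: algebra_simps)+

lemma interpolate_const: "interpolate G L (\<lambda>v. k) x = k"
  by (cases x) (simp_all add: algebra_simps)

lemma interpolate_sum:
  "interpolate G L (\<lambda>v. \<Sum>i\<in>I. f i v) x = (\<Sum>i\<in>I. interpolate G L (f i) x)"
  by (cases x) (simp_all add: sum.distrib sum_distrib_left)

lemma (in wf_digraph) interpolate_cong:
  assumes "x \<in> points G L" "\<And>v. v \<in> verts G \<Longrightarrow> f v = g v"
  shows "interpolate G L f x = interpolate G L g x"
  using assms by (cases x) (auto simp: points_def)

lemma interpolate_edge_point:
  assumes "0 < L e"
  shows "interpolate G L f (edge_point G L e s) =
    (1 - s / L e) * f (tail G e) + s / L e * f (head G e)"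
  using assms by (simp add: edge_point_def)

lemma laplacian_interpolate:
  "laplacian G L (\<lambda>w. interpolate G L (\<lambda>u. f u w) x) p =
   interpolate G L (\<lambda>u. laplacian G L (f u) p) x"
proof (cases x)
  case (Interior e s)
  have *: "(\<Sum>e'\<in>A. (\<alpha> * f a (tail G e') + \<beta> * f b (tail G e') -
        (\<alpha> * f a (head G e') + \<beta> * f b (head G e'))) / L e') =
      \<alpha> * (\<Sum>e'\<in>A. (f a (tail G e') - f a (head G e')) / L e') +
      \<beta> * (\<Sum>e'\<in>A. (f b (tail G e') - f b (head G e')) / L e')" for A \<alpha> \<beta> a b
    unfolding sum_distrib_left sum.distrib[symmetric]
    by (rule sum.cong) (simp_all add: diff_divide_distrib add_divide_distrib algebra_simps)
  show ?thesis
    unfolding laplacian_def Interior interpolate.simps * by (simp add: algebra_simps)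
qed (simp add: laplacian_def)

lemma segment_green_sym: "segment_green L x y = segment_green L y x"
  by (cases x; cases y) (simp_all add: min.commute max.commute)

text \<open>
  The resistances between the vertices are used only through the equation \<open>laplacian_r\<close>: the
  Laplacian of \<open>- r q / 2\<close> is a unit charge at \<open>q\<close> minus masses \<open>c\<close> that do not depend on
  \<open>q\<close>. These masses are those of the canonical measure of the graph, when the mass of every
  edge is divided equally between its end points.
\<close>
locale resistance_matrix = metrized +
  fixes r :: "'a \<Rightarrow> 'a \<Rightarrow> real" and c :: "'a \<Rightarrow> real"
  assumes r_sym: "p \<in> verts G \<Longrightarrow> q \<in> verts G \<Longrightarrow> r p q = r q p"
    and r_diag: "p \<in> verts G \<Longrightarrow> r p p = 0"
    and laplacian_r: "p \<in> verts G \<Longrightarrow> q \<in> verts G \<Longrightarrow>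
      laplacian G L (r q) p = 2 * c p - (if p = q then 2 else 0)"
begin

abbreviation profile :: "('a, 'b) point \<Rightarrow> 'a \<Rightarrow> real" where
  "profile x w \<equiv> interpolate G L (\<lambda>u. r u w) x"

definition form :: "('a, 'b) point \<Rightarrow> ('a, 'b) point \<Rightarrow> real" where
  "form x y = interpolate G L (profile x) y"

text \<open>
  The potential of a unit charge at \<open>x\<close> with the sinks \<open>c\<close>. A charge inside an edge acts on the
  rest of the graph as if it were distributed over the two end points with the weights of
  \<open>interpolate\<close>, which is the term with \<open>form\<close>; inside the edge, the potential differs from an affine function by the Green
  function of the segment.
\<close>
definition potential :: "('a, 'b) point \<Rightarrow> ('a, 'b) point \<Rightarrow> real" where
  "potential x y = segment_green L x y - form x y / 2"

lemma form_sym: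
  assumes "x \<in> points G L" "y \<in> points G L"
  shows "form x y = form y x"
  unfolding form_def
  by (subst interpolate_swap) (intro interpolate_cong assms r_sym)

lemma potential_sym: "x \<in> points G L \<Longrightarrow> y \<in> points G L \<Longrightarrow> potential x y = potential y x"
  by (simp add: potential_def form_sym segment_green_sym)

text \<open>
  The current of \<open>potential x\<close> along an edge consists of a constant \<open>edge_current\<close> and of the slope
  \<open>segment_current\<close> of the Green function, which jumps at \<open>x\<close>. The flag selects the value to the right
  or to the left of a point: an arc \<open>(e, s, t)\<close> leaves \<open>s\<close> to the right and enters \<open>t\<close> from the left.
\<close>

definition edge_current :: "('a, 'b) point \<Rightarrow> 'b \<Rightarrow> real" where
  "edge_current x e = (profile x (head G e) - profile x (tail G e)) / (2 * L e)"

definition segment_current :: "('a, 'b) point \<Rightarrow> 'b \<Rightarrow> bool \<Rightarrow> real \<Rightarrow> real" where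
  "segment_current x e right s = (case x of Vertex p \<Rightarrow> 0
     | Interior e0 s0 \<Rightarrow> if e = e0 then
         (if s < s0 \<or> \<not> right \<and> s = s0 then s0 / L e - 1 else s0 / L e) else 0)"

lemma segment_green_edge_point:
  assumes "e \<in> arcs G" "0 \<le> s" "s \<le> L e" "Interior e0 s0 \<in> points G L"
  shows "segment_green L (Interior e0 s0) (edge_point G L e s) =
    (if e = e0 then min s0 s * (L e - max s0 s) / L e else 0)"
proof -
  have "0 < s0" "s0 < L e0" using assms(4) by (auto simp: points_def)
  moreover consider "s = 0" | "s = L e" "s \<noteq> 0" | "s \<noteq> 0" "s \<noteq> L e" by blast
  ultimately show ?thesis
    using assms(2,3) by cases (simp_all add: edge_point_def)
qed

lemma potential_difference:
  assumes x: "x \<in> X \<inter> points G L" and a: "(e, s, t) \<in> arcs (subdivision G L X)"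
  shows "potential x (edge_point G L e s) - potential x (edge_point G L e t) =
      (t - s) * (edge_current x e + segment_current x e True s)"
    and "segment_current x e True s = segment_current x e False t"
proof -
  have e: "e \<in> arcs G" and s: "s \<in> division_points L X e" and t: "t \<in> division_points L X e"
    and st: "s < t" and no: "division_points L X e \<inter> {s<..<t} = {}"
    using a by (auto simp: in_arcs_subdivision)
  have L: "0 < L e" using e by (rule length_pos)
  have b: "0 \<le> s" "s \<le> L e" "0 \<le> t" "t \<le> L e"
    using division_pointsD[OF e s] division_pointsD[OF e t] by auto
  have F: "form x (edge_point G L e t) - form x (edge_point G L e s) =
      2 * ((t - s) * edge_current x e)"
    unfolding form_def edge_current_def interpolate_edge_point[of L, OF L]
    using L by (simp add: divide_simps) (simp add: algebra_simps)
  have "segment_green L x (edge_point G L e s) - segment_green L x (edge_point G L e t) =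
      (t - s) * segment_current x e True s \<and>
      segment_current x e True s = segment_current x e False t"
  proof (cases x)
    case (Vertex p)
    then show ?thesis by (simp add: segment_current_def)
  next
    case (Interior e0 s0)
    then have x': "Interior e0 s0 \<in> points G L" using x by simp
    note sg = segment_green_edge_point[OF e b(1,2) x'] segment_green_edge_point[OF e b(3,4) x']
    show ?thesis
    proof (cases "e = e0")
      case False
      then show ?thesis using Interior by (simp add: sg segment_current_def)
    next
      case True
      then have "s0 \<in> division_points L X e"
        using x Interior by (auto simp: division_points_def points_def)
      then have "s0 \<le> s \<or> t \<le> s0" using no by force
      then show ?thesis
      proof
        assume s0: "s0 \<le> s"
        then have "min s0 s = s0" "max s0 s = s" "min s0 t = s0" "max s0 t = t" "\<not> s < s0" "\<not> t < s0" "t \<noteq> s0"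
          using st by auto
        moreover have "s0 * (L e - s) / L e - s0 * (L e - t) / L e = (t - s) * (s0 / L e)"
          using L by (simp add: divide_simps) (simp add: algebra_simps)
        ultimately show ?thesis
          unfolding Interior sg segment_current_def using True by auto
      next
        assume s0: "t \<le> s0"
        then have "min s0 s = s" "max s0 s = s0" "min s0 t = t" "max s0 t = s0" "s < s0" "t < s0 \<or> t = s0"
          using st by auto
        moreover have "s * (L e - s0) / L e - t * (L e - s0) / L e = (t - s) * (s0 / L e - 1)"
          using L by (simp add: divide_simps) (simp add: algebra_simps)
        ultimately show ?thesis
          unfolding Interior sg segment_current_def using True by auto
      qed
    qed
  qed
  then show "potential x (edge_point G L e s) - potential x (edge_point G L e t) =
      (t - s) * (edge_current x e + segment_current x e True s)"
    and "segment_current x e True s = segment_current x e False t"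
    using F by (auto simp: potential_def distrib_left)
qed

lemma potential_current:
  assumes "x \<in> X \<inter> points G L" and "(e, s, t) \<in> arcs (subdivision G L X)"
  shows "(potential x (edge_point G L e s) - potential x (edge_point G L e t)) / (t - s) =
      edge_current x e + segment_current x e True s"
    and "(potential x (edge_point G L e s) - potential x (edge_point G L e t)) / (t - s) =
      edge_current x e + segment_current x e False t"
  using potential_difference[OF assms] assms(2) by (auto simp: in_arcs_subdivision)

definition flow :: "('a, 'b) point \<Rightarrow> 'b \<times> real \<times> real \<Rightarrow> real" where
  "flow x = (\<lambda>(e, s, t).
     (potential x (edge_point G L e s) - potential x (edge_point G L e t)) / (t - s))"

lemma laplacian_profile:
  assumes v: "v \<in> verts G" and x: "x \<in> points G L"
  shows "laplacian G L (profile x) v = 2 * c v - 2 * interpolate G L (\<lambda>w. if w = v then 1 else 0) x"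
proof -
  have "laplacian G L (profile x) v = interpolate G L (\<lambda>w. 2 * c v - 2 * (if w = v then 1 else 0)) x"
    unfolding laplacian_interpolate
    by (rule interpolate_cong[OF x]) (simp add: laplacian_r v)
  then show ?thesis by (simp add: interpolate_linear interpolate_const)
qed

lemma edge_current_divergence:
  assumes v: "v \<in> verts G" and x: "x \<in> points G L"
  shows "(\<Sum>e\<in>out_arcs G v. edge_current x e) - (\<Sum>e\<in>in_arcs G v. edge_current x e) =
    interpolate G L (\<lambda>w. if w = v then 1 else 0) x - c v"
proof -
  have *: "edge_current x e = (- 1/2) * ((profile x (tail G e) - profile x (head G e)) / L e)" for e
    by (simp add: edge_current_def diff_divide_distrib mult.commute)
  have "(\<Sum>e\<in>out_arcs G v. edge_current x e) - (\<Sum>e\<in>in_arcs G v. edge_current x e) =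
      - laplacian G L (profile x) v / 2"
    unfolding laplacian_def * sum_distrib_left[symmetric] by simp
  then show ?thesis by (simp add: laplacian_profile[OF v x])
qed

lemma segment_current_divergence:
  assumes x: "x \<in> points G L"
  shows "(\<Sum>e\<in>out_arcs G v. segment_current x e True 0) -
      (\<Sum>e\<in>in_arcs G v. segment_current x e False (L e)) =
    (if x = Vertex v then 1 else 0) - interpolate G L (\<lambda>w. if w = v then 1 else 0) x"
proof (cases x)
  case (Vertex p)
  then show ?thesis by (simp add: segment_current_def)
next
  case (Interior e0 s0)
  then have e0: "e0 \<in> arcs G" and s0: "0 < s0" "s0 < L e0"
    using x by (auto simp: points_def)
  have outgoing: "segment_current x e True 0 = (if e = e0 then s0 / L e0 - 1 else 0)" for e
    using s0 by (simp add: segment_current_def Interior)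
  have incoming: "segment_current x e False (L e) = (if e = e0 then s0 / L e0 else 0)" for e
    using s0 by (simp add: segment_current_def Interior)
  show ?thesis
    unfolding outgoing incoming using e0 by (simp add: sum.delta finite_out_arcs finite_in_arcs Interior)
qed

text \<open>
  The sinks \<open>c\<close> at the vertices do not depend on the source \<open>x\<close>; they cancel in the difference of
  two such flows.
\<close>
lemma flow_divergence:
  assumes X: "finite X" and x: "x \<in> X \<inter> points G L" and z: "z \<in> verts (subdivision G L X)"
  shows "(\<Sum>a\<in>out_arcs (subdivision G L X) z. flow x a) -
      (\<Sum>a\<in>in_arcs (subdivision G L X) z. flow x a) =
    (if z = x then 1 else 0) - (case z of Vertex v \<Rightarrow> c v | Interior e s \<Rightarrow> 0)"
proof -
  have r: "flow x (e, s, t) = edge_current x e + segment_current x e True s"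
    and l: "flow x (e, s, t) = edge_current x e + segment_current x e False t"
    if "(e, s, t) \<in> arcs (subdivision G L X)" for e s t
    using potential_current[OF x that] by (simp_all add: flow_def)
  show ?thesis
  proof (cases z)
    case (Vertex v)
    then have v: "v \<in> verts G" using z by (auto simp: subdivision_def points_def)
    have "(\<Sum>a\<in>out_arcs (subdivision G L X) z. flow x a) =
        (\<Sum>e\<in>out_arcs G v. edge_current x e + segment_current x e True 0)"
      unfolding Vertex using r
      by (rule sum_out_arcs_subdivision_Vertex[OF X, of _ "\<lambda>e s. edge_current x e + segment_current x e True s"])
    moreover have "(\<Sum>a\<in>in_arcs (subdivision G L X) z. flow x a) =
        (\<Sum>e\<in>in_arcs G v. edge_current x e + segment_current x e False (L e))"
      unfolding Vertex using l
      by (rule sum_in_arcs_subdivision_Vertex[OF X, of _ "\<lambda>e s. edge_current x e + segment_current x e False s"])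
    ultimately show ?thesis
      using edge_current_divergence[OF v, of x] segment_current_divergence[of x v] x
      by (auto simp add: Vertex sum.distrib)
  next
    case (Interior e s)
    then have zX: "Interior e s \<in> X \<inter> points G L" using z by (auto simp: subdivision_def)
    have "(\<Sum>a\<in>out_arcs (subdivision G L X) z. flow x a) =
        edge_current x e + segment_current x e True s"
      unfolding Interior using r
      by (rule sum_out_arcs_subdivision_Interior[OF X zX, of _ "\<lambda>e s. edge_current x e + segment_current x e True s"])
    moreover have "(\<Sum>a\<in>in_arcs (subdivision G L X) z. flow x a) =
        edge_current x e + segment_current x e False s"
      unfolding Interior using l
      by (rule sum_in_arcs_subdivision_Interior[OF X zX, of _ "\<lambda>e s. edge_current x e + segment_current x e False s"])
    moreover have "segment_current x e True s - segment_current x e False s = (if z = x then 1 else 0)"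
      by (auto simp: segment_current_def Interior split: point.splits)
    ultimately show ?thesis by (simp add: Interior)
  qed
qed

lemma unit_current_potential:
  assumes x: "x \<in> points G L" and y: "y \<in> points G L"
  shows "unit_current (subdivision G L {x, y}) (\<lambda>(e, s, t). t - s) x y
    (\<lambda>z. potential x z - potential y z) (\<lambda>a. flow x a - flow y a)"
  unfolding unit_current_def
proof (intro conjI ballI)
  fix a assume "a \<in> arcs (subdivision G L {x, y})"
  moreover obtain e s t where "a = (e, s, t)" by (cases a)
  ultimately show "potential x (tail (subdivision G L {x, y}) a) - potential y (tail (subdivision G L {x, y}) a) -
      (potential x (head (subdivision G L {x, y}) a) - potential y (head (subdivision G L {x, y}) a)) =
      (case a of (e, s, t) \<Rightarrow> t - s) * (flow x a - flow y a)"
    by (simp add: flow_def tail_subdivision head_subdivision in_arcs_subdivision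
        diff_divide_distrib[symmetric])
next
  fix z assume z: "z \<in> verts (subdivision G L {x, y})"
  show "(\<Sum>a\<in>out_arcs (subdivision G L {x, y}) z. flow x a - flow y a) -
      (\<Sum>a\<in>in_arcs (subdivision G L {x, y}) z. flow x a - flow y a) =
      (if z = x then 1 else 0) - (if z = y then 1 else 0)"
    using flow_divergence[OF _ _ z, of x] flow_divergence[OF _ _ z, of y] x y
    by (simp add: sum_subtractf)
qed

lemma points_in_verts_subdivision:
  "x \<in> X \<Longrightarrow> x \<in> points G L \<Longrightarrow> x \<in> verts (subdivision G L X)"
  by (simp add: subdivision_def)

theorem resistance_eq:
  assumes x: "x \<in> points G L" and y: "y \<in> points G L"
  shows "resistance G L x y = potential x x + potential y y - 2 * potential x y"
proof -
  interpret S: fin_digraph "subdivision G L {x, y}" by (rule fin_digraph_subdivision) simp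
  show ?thesis
    unfolding resistance_def
    by (subst S.effective_resistance_eq[OF _ _ unit_current_potential[OF x y]])
      (use x y potential_sym[OF x y] in \<open>simp_all add: points_in_verts_subdivision\<close>)
qed

lemma resistance_nonneg:
  assumes x: "x \<in> points G L" and y: "y \<in> points G L"
  shows "0 \<le> resistance G L x y"
proof -
  interpret S: fin_digraph "subdivision G L {x, y}" by (rule fin_digraph_subdivision) simp
  have "0 \<le> (potential x x - potential y x) - (potential x y - potential y y)"
    by (rule S.unit_current_potential_nonneg[OF _ _ unit_current_potential[OF x y]])
      (use x y in \<open>auto simp: points_in_verts_subdivision in_arcs_subdivision\<close>)
  then show ?thesis
    unfolding resistance_eq[OF x y] using potential_sym[OF x y] by simp
qed

end

section \<open>Integration on a metrized graph\<close>

lemma measurable_Interior: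
  assumes "e \<in> arcs G"
  shows "Interior e \<in> measurable (restrict_space lborel {0<..<L e}) (graph_measure G L m c)"
proof (rule measurableI)
  fix t assume "t \<in> space (restrict_space lborel {0<..<L e})"
  then show "Interior e t \<in> space (graph_measure G L m c)"
    using assms by (auto simp: space_graph_measure points_def space_restrict_space)
next
  fix A assume "A \<in> sets (graph_measure G L m c)"
  then have "{t \<in> {0<..<L e}. Interior e t \<in> A} \<in> sets borel"
    using assms by (simp add: sets_graph_measure graph_sets_def)
  moreover have "Interior e -` A \<inter> space (restrict_space lborel {0<..<L e}) =
      {t \<in> {0<..<L e}. Interior e t \<in> A}"
    by (auto simp: space_restrict_space)
  ultimately show "Interior e -` A \<inter> space (restrict_space lborel {0<..<L e})
      \<in> sets (restrict_space lborel {0<..<L e})"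
    by (auto simp: sets_restrict_space_iff)
qed

text \<open>
  The measure is a finite sum of point masses and of images of Lebesgue measures, and so is its
  integral; the induction over measurable functions avoids introducing these summands as measures.
\<close>
lemma nn_integral_graph_measure:
  assumes "f \<in> borel_measurable (graph_measure G L m c)"
  shows "(\<integral>\<^sup>+x. f x \<partial>graph_measure G L m c) =
    (\<Sum>p\<in>verts G. m p * f (Vertex p)) +
    (\<Sum>e\<in>arcs G. c e * (\<integral>\<^sup>+t. f (Interior e t) \<partial>restrict_space lborel {0<..<L e}))"
  using assms
proof (induction rule: borel_measurable_induct)
  case (cong f g)
  have "(\<integral>\<^sup>+x. f x \<partial>graph_measure G L m c) = (\<integral>\<^sup>+x. g x \<partial>graph_measure G L m c)"
    by (rule nn_integral_cong) (simp add: cong)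
  moreover have "f (Vertex p) = g (Vertex p)" if "p \<in> verts G" for p
    using that by (intro cong) (simp add: space_graph_measure points_def)
  moreover have "(\<integral>\<^sup>+t. f (Interior e t) \<partial>restrict_space lborel {0<..<L e}) =
      (\<integral>\<^sup>+t. g (Interior e t) \<partial>restrict_space lborel {0<..<L e})" if "e \<in> arcs G" for e
    using that
    by (intro nn_integral_cong cong) (auto simp: space_restrict_space space_graph_measure points_def)
  ultimately show ?case using cong by simp
next
  case (set A)
  have "(\<integral>\<^sup>+t. indicator A (Interior e t) \<partial>restrict_space lborel {0<..<L e}) =
      emeasure lborel {t \<in> {0<..<L e}. Interior e t \<in> A}" if "e \<in> arcs G" for e
  proof -
    have "{t \<in> {0<..<L e}. Interior e t \<in> A} \<in> sets lborel"
      using set that by (simp add: sets_graph_measure graph_sets_def)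
    then have "(\<integral>\<^sup>+t. indicator {t \<in> {0<..<L e}. Interior e t \<in> A} t \<partial>lborel) =
        emeasure lborel {t \<in> {0<..<L e}. Interior e t \<in> A}"
      by (rule nn_integral_indicator)
    moreover have "(\<integral>\<^sup>+t. indicator A (Interior e t) \<partial>restrict_space lborel {0<..<L e}) =
        (\<integral>\<^sup>+t. indicator {t \<in> {0<..<L e}. Interior e t \<in> A} t \<partial>lborel)"
      by (subst nn_integral_restrict_space) (auto intro!: nn_integral_cong simp: indicator_def)
    ultimately show ?thesis by simp
  qed
  then show ?case
    using set by (simp add: sets_graph_measure emeasure_graph_measure)
next
  case (mult u k)
  then show ?case
    using measurable_compose[OF measurable_Interior mult(2)]
    by (simp add: nn_integral_cmult distrib_left sum_distrib_left mult.left_commute)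
next
  case (add u v)
  have "(\<integral>\<^sup>+t. v (Interior e t) + u (Interior e t) \<partial>restrict_space lborel {0<..<L e}) =
      (\<integral>\<^sup>+t. v (Interior e t) \<partial>restrict_space lborel {0<..<L e}) +
      (\<integral>\<^sup>+t. u (Interior e t) \<partial>restrict_space lborel {0<..<L e})" if "e \<in> arcs G" for e
    by (intro nn_integral_add measurable_compose[OF measurable_Interior[OF that]]) (use add in auto)
  then show ?case
    using add by (simp add: nn_integral_add distrib_left sum.distrib algebra_simps)
next
  case (seq U)
  have incU: "incseq (\<lambda>i. U i x)" for x
    using seq by (auto simp: incseq_def le_fun_def)
  have e: "(\<integral>\<^sup>+t. (SUP i. U i (Interior e t)) \<partial>restrict_space lborel {0<..<L e}) =
      (SUP i. \<integral>\<^sup>+t. U i (Interior e t) \<partial>restrict_space lborel {0<..<L e})" if "e \<in> arcs G" for e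
    by (intro nn_integral_monotone_convergence_SUP measurable_compose[OF measurable_Interior[OF that]])
      (use seq in \<open>auto simp: incseq_def le_fun_def\<close>)
  have inc_e: "incseq (\<lambda>i. \<integral>\<^sup>+t. U i (Interior e t) \<partial>restrict_space lborel {0<..<L e})" for e
    using incU by (auto intro!: incseq_SucI nn_integral_mono dest: incseq_SucD)
  have "(\<integral>\<^sup>+x. (SUP i. U i x) \<partial>graph_measure G L m c) =
      (SUP i. \<integral>\<^sup>+x. U i x \<partial>graph_measure G L m c)"
    by (rule nn_integral_monotone_convergence_SUP) (use seq in auto)
  also have "\<dots> = (SUP i. (\<Sum>p\<in>verts G. m p * U i (Vertex p)) +
      (\<Sum>e\<in>arcs G. c e * (\<integral>\<^sup>+t. U i (Interior e t) \<partial>restrict_space lborel {0<..<L e})))"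
    using seq by simp
  also have "\<dots> = (\<Sum>p\<in>verts G. m p * (SUP i. U i (Vertex p))) +
      (\<Sum>e\<in>arcs G. c e * (SUP i. \<integral>\<^sup>+t. U i (Interior e t) \<partial>restrict_space lborel {0<..<L e}))"
    using incU inc_e
    by (subst ennreal_SUP_add)
      (auto simp: ennreal_SUP_sum[symmetric] SUP_mult_left_ennreal incseq_def
         intro!: sum_mono mult_left_mono arg_cong2[where f = "(+)"] ennreal_SUP_sum)
  finally show ?case using e by (simp add: image_comp)
qed

text \<open>
  For a nonnegative integrand, integrability along every edge already implies measurability on the
  graph and gives the value of the integral.
\<close>
lemma lebesgue_integral_graph_measure:
  fixes f :: "('v, 'e) point \<Rightarrow> real"
  assumes m: "\<And>p. p \<in> verts G \<Longrightarrow> m p = ennreal (m' p) \<and> 0 \<le> m' p"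
    and c: "\<And>e. e \<in> arcs G \<Longrightarrow> c e = ennreal (c' e) \<and> 0 \<le> c' e"
    and f: "\<And>x. x \<in> points G L \<Longrightarrow> 0 \<le> f x"
    and I: "\<And>e. e \<in> arcs G \<Longrightarrow>
      has_bochner_integral lborel (\<lambda>t. indicator {0<..<L e} t *\<^sub>R f (Interior e t)) (I e)"
  shows "(LINT x|graph_measure G L m c. f x) =
    (\<Sum>p\<in>verts G. m' p * f (Vertex p)) + (\<Sum>e\<in>arcs G. c' e * I e)"
proof -
  let ?M = "graph_measure G L m c"
  have f_e: "0 \<le> indicator {0<..<L e} t *\<^sub>R f (Interior e t)" if "e \<in> arcs G" for e t
    using f[of "Interior e t"] that by (auto simp: points_def indicator_def)
  have I0: "0 \<le> I e" if "e \<in> arcs G" for e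
  proof -
    have "0 \<le> (LBINT t. indicator {0<..<L e} t *\<^sub>R f (Interior e t))"
      by (rule Bochner_Integration.integral_nonneg) (rule f_e[OF that])
    then show ?thesis using I[OF that] by (simp add: has_bochner_integral_iff)
  qed
  have fM: "f \<in> borel_measurable ?M"
  proof (rule measurableI)
    fix A :: "real set" assume A: "A \<in> sets borel"
    have "{t \<in> {0<..<L e}. Interior e t \<in> f -` A \<inter> points G L} \<in> sets borel" if e: "e \<in> arcs G" for e
    proof -
      have "(\<lambda>t. indicator {0<..<L e} t *\<^sub>R f (Interior e t)) \<in> borel_measurable borel"
        using I[OF e] by (auto dest: borel_measurable_has_bochner_integral)
      then have "(\<lambda>t. indicator {0<..<L e} t *\<^sub>R f (Interior e t)) -` A \<inter> space borel \<inter> {0<..<L e}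
          \<in> sets borel"
        using A by (intro sets.Int measurable_sets) auto
      also have "(\<lambda>t. indicator {0<..<L e} t *\<^sub>R f (Interior e t)) -` A \<inter> space borel \<inter> {0<..<L e} =
          {t \<in> {0<..<L e}. Interior e t \<in> f -` A \<inter> points G L}"
        using e by (auto simp: points_def)
      finally show ?thesis .
    qed
    then show "f -` A \<inter> space ?M \<in> sets ?M"
      by (auto simp: sets_graph_measure graph_sets_def space_graph_measure)
  qed simp
  have *: "(\<integral>\<^sup>+t. ennreal (f (Interior e t)) \<partial>restrict_space lborel {0<..<L e}) = ennreal (I e)"
    if e: "e \<in> arcs G" for e
  proof -
    have "(\<integral>\<^sup>+t. ennreal (f (Interior e t)) \<partial>restrict_space lborel {0<..<L e}) =
        (\<integral>\<^sup>+t. ennreal (indicator {0<..<L e} t *\<^sub>R f (Interior e t)) \<partial>lborel)"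
      by (subst nn_integral_restrict_space) (auto intro!: nn_integral_cong simp: indicator_def)
    also have "\<dots> = ennreal (I e)"
      using I[OF e] f_e[OF e] by (simp add: has_bochner_integral_iff nn_integral_eq_integral)
    finally show ?thesis .
  qed
  have "(\<integral>\<^sup>+x. ennreal (f x) \<partial>?M) =
      (\<Sum>p\<in>verts G. ennreal (m' p * f (Vertex p))) + (\<Sum>e\<in>arcs G. ennreal (c' e * I e))"
    using fM m c f by (subst nn_integral_graph_measure)
      (auto simp: * ennreal_mult I0 points_def intro!: arg_cong2[where f = "(+)"] sum.cong)
  also have "\<dots> = ennreal ((\<Sum>p\<in>verts G. m' p * f (Vertex p)) + (\<Sum>e\<in>arcs G. c' e * I e))"
    using m c f I0
    by (subst (1 2) sum_ennreal) (auto simp: points_def ennreal_plus intro!: sum_nonneg ennreal_plus[symmetric])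
  finally have nn: "(\<integral>\<^sup>+x. ennreal (f x) \<partial>?M) = \<dots>" .
  have "0 \<le> (\<Sum>p\<in>verts G. m' p * f (Vertex p)) + (\<Sum>e\<in>arcs G. c' e * I e)"
    using m c f I0 by (auto simp: points_def intro!: add_nonneg_nonneg sum_nonneg mult_nonneg_nonneg)
  moreover have "(LINT x|?M. f x) = enn2real (\<integral>\<^sup>+x. ennreal (f x) \<partial>?M)"
    using f by (intro integral_eq_nn_integral fM AE_I2) (simp add: space_graph_measure)
  ultimately show ?thesis using nn by simp
qed

lemma has_bochner_integral_quadratic:
  fixes g :: "real \<Rightarrow> real"
  assumes ab: "a \<le> b" and g: "\<And>t. a < t \<Longrightarrow> t < b \<Longrightarrow> g t = \<alpha> + \<beta> * t + \<gamma> * t\<^sup>2"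
    and I: "I = (\<alpha> * b + \<beta> * b\<^sup>2 / 2 + \<gamma> * b ^ 3 / 3) - (\<alpha> * a + \<beta> * a\<^sup>2 / 2 + \<gamma> * a ^ 3 / 3)"
  shows "has_bochner_integral lborel (\<lambda>t. indicator {a<..<b} t *\<^sub>R g t) I"
proof -
  have "has_bochner_integral lborel (\<lambda>t. indicator {a..b} t *\<^sub>R (\<alpha> + \<beta> * t + \<gamma> * t\<^sup>2)) I"
    unfolding I
    by (rule has_bochner_integral_FTC_Icc[OF ab, where F = "\<lambda>t. \<alpha> * t + \<beta> * t\<^sup>2 / 2 + \<gamma> * t ^ 3 / 3"])
      (auto intro!: derivative_eq_intros continuous_intros
        simp: has_real_derivative_iff_has_vector_derivative[symmetric] power2_eq_square)
  then show ?thesis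
    by (rule has_bochner_integral_discrete_difference[where X = "{a, b}", THEN iffD1, rotated 4])
      (auto simp: g indicator_def)
qed

lemma has_bochner_integral_split:
  fixes g :: "real \<Rightarrow> real"
  assumes s: "a < s" "s < b"
    and "has_bochner_integral lborel (\<lambda>t. indicator {a<..<s} t *\<^sub>R g t) I"
    and "has_bochner_integral lborel (\<lambda>t. indicator {s<..<b} t *\<^sub>R g t) J"
  shows "has_bochner_integral lborel (\<lambda>t. indicator {a<..<b} t *\<^sub>R g t) (I + J)"
  by (rule has_bochner_integral_discrete_difference[where X = "{s}", THEN iffD1, rotated 4,
        OF has_bochner_integral_add[OF assms(3,4)]])
    (use s in \<open>auto simp: indicator_def\<close>)

section \<open>Resistances between vertices and deletion of an edge\<close>

lemma (in metrized) resistance_Vertex: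
  assumes pq: "p \<in> verts G" "p' \<in> verts G" and ui: "unit_current G L p p' u i"
  shows "resistance G L (Vertex p) (Vertex p') = u p - u p'"
proof -
  let ?X = "{Vertex p, Vertex p'} :: ('a, 'b) point set"
  interpret S: fin_digraph "subdivision G L ?X" by (rule fin_digraph_subdivision) simp
  define u' where "u' z = (case z of Vertex v \<Rightarrow> u v | Interior e s \<Rightarrow> 0)" for z :: "('a, 'b) point"
  have arc: "e \<in> arcs G \<and> s = 0 \<and> t = L e" if "(e, s, t) \<in> arcs (subdivision G L ?X)" for e s t
    using that by (auto simp: in_arcs_subdivision division_points_def dest: length_pos)
  have "unit_current (subdivision G L ?X) (\<lambda>(e, s, t). t - s) (Vertex p) (Vertex p') u' (\<lambda>(e, s, t). i e)"
    unfolding unit_current_def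
  proof (intro conjI ballI)
    fix a assume a: "a \<in> arcs (subdivision G L ?X)"
    obtain e s t where est: "a = (e, s, t)" by (cases a)
    with arc a have e: "e \<in> arcs G" and "s = 0" "t = L e" by auto
    then show "u' (tail (subdivision G L ?X) a) - u' (head (subdivision G L ?X) a) =
        (case a of (e, s, t) \<Rightarrow> t - s) * (case a of (e, s, t) \<Rightarrow> i e)"
      using ui length_pos[OF e]
      by (simp add: est tail_subdivision head_subdivision edge_point_def u'_def unit_current_def)
  next
    fix z assume "z \<in> verts (subdivision G L ?X)"
    then obtain v where z: "z = Vertex v" and v: "v \<in> verts G"
      using pq by (auto simp: subdivision_def points_def)
    have "(\<Sum>a\<in>out_arcs (subdivision G L ?X) z. case a of (e, s, t) \<Rightarrow> i e) = (\<Sum>e\<in>out_arcs G v. i e)"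
      unfolding z by (rule sum_out_arcs_subdivision_Vertex) auto
    moreover have "(\<Sum>a\<in>in_arcs (subdivision G L ?X) z. case a of (e, s, t) \<Rightarrow> i e) = (\<Sum>e\<in>in_arcs G v. i e)"
      unfolding z by (rule sum_in_arcs_subdivision_Vertex) auto
    ultimately show "(\<Sum>a\<in>out_arcs (subdivision G L ?X) z. case a of (e, s, t) \<Rightarrow> i e) -
        (\<Sum>a\<in>in_arcs (subdivision G L ?X) z. case a of (e, s, t) \<Rightarrow> i e) =
        (if z = Vertex p then 1 else 0) - (if z = Vertex p' then 1 else 0)"
      using ui v by (simp add: unit_current_def z)
  qed
  then show ?thesis
    unfolding resistance_def
    using pq by (subst S.effective_resistance_eq) (auto simp: subdivision_def u'_def)
qed

lemma (in metrized) metrized_del_arc: "metrized (del_arc e) L"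
  by unfold_locales (auto intro: length_pos)

context resistance_matrix
begin

lemma unit_current_vertices:
  assumes "p \<in> verts G" "p' \<in> verts G"
  shows "unit_current G L p p' (\<lambda>v. (r p' v - r p v) / 2)
    (\<lambda>e. ((r p' (tail G e) - r p (tail G e)) / 2 - (r p' (head G e) - r p (head G e)) / 2) / L e)"
  unfolding unit_current_def
proof (intro conjI ballI)
  fix e assume "e \<in> arcs G"
  then show "(r p' (tail G e) - r p (tail G e)) / 2 - (r p' (head G e) - r p (head G e)) / 2 =
      L e * (((r p' (tail G e) - r p (tail G e)) / 2 - (r p' (head G e) - r p (head G e)) / 2) / L e)"
    using length_pos[of e] by simp
next
  fix v assume v: "v \<in> verts G"
  have *: "((r p' (tail G e) - r p (tail G e)) / 2 - (r p' (head G e) - r p (head G e)) / 2) / L e =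
      ((r p' (tail G e) - r p' (head G e)) / L e) / 2 - ((r p (tail G e) - r p (head G e)) / L e) / 2" for e
    by (simp add: diff_divide_distrib)
  show "(\<Sum>e\<in>out_arcs G v. ((r p' (tail G e) - r p (tail G e)) / 2 - (r p' (head G e) - r p (head G e)) / 2) / L e) -
      (\<Sum>e\<in>in_arcs G v. ((r p' (tail G e) - r p (tail G e)) / 2 - (r p' (head G e) - r p (head G e)) / 2) / L e) =
      (if v = p then 1 else 0) - (if v = p' then 1 else 0)"
    using laplacian_r[OF v assms(1)] laplacian_r[OF v assms(2)]
    unfolding * sum_subtractf sum_divide_distrib[symmetric] laplacian_def
    by (auto split: if_splits)
qed

lemma resistance_vertices:
  assumes "p \<in> verts G" "p' \<in> verts G"
  shows "resistance G L (Vertex p) (Vertex p') = r p p'"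
  using resistance_Vertex[OF assms unit_current_vertices[OF assms]] assms
  by (simp add: r_diag r_sym)

text \<open>
  The unit current between the end points of \<open>e\<close> carries \<open>R / L e\<close> through \<open>e\<close>, where \<open>R\<close> is the
  resistance in the full graph. Deleting \<open>e\<close> leaves a current of strength \<open>1 - R / L e\<close> under the same
  potentials, and rescaling it to a unit current gives the resistance of the remaining graph.
\<close>
lemma resistance_del_arc:
  assumes e: "e \<in> arcs G" and less: "r (tail G e) (head G e) < L e"
  shows "resistance (del_arc e) L (Vertex (tail G e)) (Vertex (head G e)) =
    L e * r (tail G e) (head G e) / (L e - r (tail G e) (head G e))"
proof -
  interpret D: metrized "del_arc e" L by (rule metrized_del_arc)
  let ?R = "r (tail G e) (head G e)"
  \<comment> \<open>the factor that rescales the current remaining after the deletion to a unit current\<close>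
  define k where "k = L e / (L e - ?R)"
  have L: "0 < L e" using e by (rule length_pos)
  have V: "tail G e \<in> verts G" "head G e \<in> verts G" using e by auto
  define u where "u v = (r (head G e) v - r (tail G e) v) / 2" for v
  define i where "i e' = (u (tail G e') - u (head G e')) / L e'" for e'
  have ui: "unit_current G L (tail G e) (head G e) u i"
    using unit_current_vertices[OF V] unfolding u_def i_def .
  have u: "u (tail G e) - u (head G e) = ?R"
    using V by (simp add: u_def r_diag r_sym)
  have i: "i e = ?R / L e" by (simp add: i_def u)
  have k: "k * (1 - i e) = 1"
    using L less by (simp add: k_def i field_simps)
  have outgoing: "(\<Sum>e'\<in>out_arcs (del_arc e) v. k * i e') =
      k * ((\<Sum>e'\<in>out_arcs G v. i e') - (if v = tail G e then i e else 0))" for v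
    using e by (auto simp: out_arcs_del_arc_iff sum_distrib_left[symmetric] sum_diff1 finite_out_arcs)
  have incoming: "(\<Sum>e'\<in>in_arcs (del_arc e) v. k * i e') =
      k * ((\<Sum>e'\<in>in_arcs G v. i e') - (if v = head G e then i e else 0))" for v
    using e by (auto simp: in_arcs_del_arc_iff sum_distrib_left[symmetric] sum_diff1 finite_in_arcs)
  have "unit_current (del_arc e) L (tail G e) (head G e) (\<lambda>v. k * u v) (\<lambda>e'. k * i e')"
    unfolding unit_current_def
  proof (intro conjI ballI)
    fix e' assume "e' \<in> arcs (del_arc e)"
    then show "k * u (tail (del_arc e) e') - k * u (head (del_arc e) e') = L e' * (k * i e')"
      using ui by (simp add: unit_current_def right_diff_distrib[symmetric])
  next
    fix v assume "v \<in> verts (del_arc e)"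
    then have "(\<Sum>e'\<in>out_arcs G v. i e') - (\<Sum>e'\<in>in_arcs G v. i e') =
        (if v = tail G e then 1 else 0) - (if v = head G e then 1 else 0)"
      using ui by (simp add: unit_current_def)
    then have "k * ((\<Sum>e'\<in>out_arcs G v. i e') - (if v = tail G e then i e else 0)) -
        k * ((\<Sum>e'\<in>in_arcs G v. i e') - (if v = head G e then i e else 0)) =
        (k * (1 - i e)) * ((if v = tail G e then 1 else 0) - (if v = head G e then 1 else 0))"
      by (simp add: right_diff_distrib[symmetric] split: if_splits)
    then show "(\<Sum>e'\<in>out_arcs (del_arc e) v. k * i e') - (\<Sum>e'\<in>in_arcs (del_arc e) v. k * i e') =
        (if v = tail G e then 1 else 0) - (if v = head G e then 1 else 0)"
      unfolding outgoing incoming k by simp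
  qed
  then have "resistance (del_arc e) L (Vertex (tail G e)) (Vertex (head G e)) =
      k * u (tail G e) - k * u (head G e)"
    using V by (intro D.resistance_Vertex) auto
  also have "\<dots> = k * ?R" by (simp only: u right_diff_distrib[symmetric])
  finally show ?thesis by (simp add: k_def)
qed

end

section \<open>The tau constant\<close>

context resistance_matrix
begin

text \<open>
  With \<open>R'\<close> the resistance after deletion of \<open>e\<close>, this is \<open>1 / (L e + R')\<close>, the density of the
  admissible measure on \<open>e\<close> up to the factor \<open>1 / g\<close>. Away from its other argument,
  the resistance function has second derivative \<open>- 2 * kappa e\<close> along \<open>e\<close>.
\<close>
definition kappa :: "'b \<Rightarrow> real" where
  "kappa e = (L e - r (tail G e) (head G e)) / (L e)\<^sup>2"

definition rho :: real where
  "rho = (\<Sum>v\<in>verts G. \<Sum>w\<in>verts G. c v * c w * r v w)"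

text \<open>
  Three times the integral of the squared derivative of \<open>potential x x\<close>.
\<close>
definition diagonal_energy :: real where
  "diagonal_energy = (\<Sum>e\<in>arcs G. (kappa e)\<^sup>2 * L e ^ 3)"

lemma green_identity:
  "(\<Sum>e\<in>arcs G. (f (tail G e) - f (head G e)) * (g (tail G e) - g (head G e)) / L e) =
   (\<Sum>v\<in>verts G. f v * laplacian G L g v)"
  using sum_arcs_difference[of f "\<lambda>e. (g (tail G e) - g (head G e)) / L e"]
  by (simp add: laplacian_def)

lemma sum_indicator_verts:
  "w \<in> verts G \<Longrightarrow> (\<Sum>v\<in>verts G. f v * (if v = w then 2 else 0)) = 2 * f w" for f :: "'a \<Rightarrow> real"
  by (simp add: if_distrib[of "\<lambda>x. _ * x"] sum.delta cong: if_cong)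

lemma green_identity_r:
  assumes w: "w \<in> verts G"
  shows "(\<Sum>e\<in>arcs G. (f (tail G e) - f (head G e)) * (r w (tail G e) - r w (head G e)) / L e) =
    2 * (\<Sum>v\<in>verts G. c v * f v) - 2 * f w"
proof -
  have "(\<Sum>v\<in>verts G. f v * laplacian G L (r w) v) =
      (\<Sum>v\<in>verts G. 2 * (c v * f v) - f v * (if v = w then 2 else 0))"
    by (rule sum.cong) (simp_all add: laplacian_r w algebra_simps)
  then show ?thesis
    unfolding green_identity
    by (simp add: sum_subtractf sum_indicator_verts w sum_distrib_left)
qed

lemma sum_c: "v \<in> verts G \<Longrightarrow> (\<Sum>v\<in>verts G. c v) = 1"
  using green_identity_r[of v "\<lambda>_. 1"] by simp

text \<open>
  The canonical masses are in equilibrium: their potential is constant on the vertices. The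
  Dirichlet pairing of \<open>r v\<close> and \<open>r w\<close> is symmetric, and Green's identity evaluates it to twice
  the potential at \<open>v\<close> minus \<open>2 * r v w\<close>.
\<close>
lemma sum_c_r_const:
  assumes v: "v \<in> verts G" and w: "w \<in> verts G"
  shows "(\<Sum>u\<in>verts G. c u * r v u) = (\<Sum>u\<in>verts G. c u * r w u)"
proof -
  have "(\<Sum>e\<in>arcs G. (r v (tail G e) - r v (head G e)) * (r w (tail G e) - r w (head G e)) / L e) =
      (\<Sum>e\<in>arcs G. (r w (tail G e) - r w (head G e)) * (r v (tail G e) - r v (head G e)) / L e)"
    by (simp add: mult.commute)
  then show ?thesis
    unfolding green_identity_r[OF v] green_identity_r[OF w] using r_sym[OF v w] by simp
qed

lemma sum_c_r:
  assumes v: "v \<in> verts G"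
  shows "(\<Sum>u\<in>verts G. c u * r v u) = rho"
proof -
  have "rho = (\<Sum>w\<in>verts G. c w * (\<Sum>u\<in>verts G. c u * r w u))"
    by (simp add: rho_def sum_distrib_left mult.assoc)
  also have "\<dots> = (\<Sum>w\<in>verts G. c w * (\<Sum>u\<in>verts G. c u * r v u))"
    by (intro sum.cong refl arg_cong2[where f = "(*)"] sum_c_r_const v)
  also have "\<dots> = (\<Sum>u\<in>verts G. c u * r v u)"
    unfolding sum_distrib_right[symmetric] using sum_c[OF v] by simp
  finally show ?thesis by simp
qed

lemma sum_c_profile:
  assumes y: "y \<in> points G L"
  shows "(\<Sum>v\<in>verts G. c v * profile y v) = rho"
proof -
  have "(\<Sum>v\<in>verts G. c v * profile y v) = interpolate G L (\<lambda>u. \<Sum>v\<in>verts G. c v * r u v) y"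
    by (simp add: interpolate_sum interpolate_linear)
  also have "\<dots> = interpolate G L (\<lambda>u. rho) y"
    by (rule interpolate_cong[OF y]) (rule sum_c_r)
  finally show ?thesis by (simp add: interpolate_const)
qed

text \<open>
  The first contribution to the tau constant. It depends on \<open>y\<close> only through \<open>form y y\<close>, which
  vanishes if \<open>y\<close> is a vertex and is compensated by the edge containing \<open>y\<close> otherwise, see
  \<open>resistance_deriv_integral\<close>.
\<close>
lemma sum_profile_energy:
  assumes y: "y \<in> points G L"
  shows "(\<Sum>e\<in>arcs G. (profile y (head G e) - profile y (tail G e))\<^sup>2 / L e) = 2 * rho - 2 * form y y"
proof -
  have "(\<Sum>e\<in>arcs G. (profile y (head G e) - profile y (tail G e))\<^sup>2 / L e) =
      (\<Sum>v\<in>verts G. profile y v * laplacian G L (profile y) v)"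
    unfolding green_identity[symmetric]
    by (simp add: power2_eq_square algebra_simps)
  also have "\<dots> = (\<Sum>v\<in>verts G. 2 * (c v * profile y v) -
      2 * interpolate G L (\<lambda>w. profile y v * (if w = v then 1 else 0)) y)"
    by (rule sum.cong) (simp_all add: laplacian_profile y interpolate_linear algebra_simps)
  also have "\<dots> = 2 * rho -
      2 * interpolate G L (\<lambda>w. \<Sum>v\<in>verts G. profile y v * (if w = v then 1 else 0)) y"
    unfolding sum_subtractf sum_distrib_left[symmetric] sum_c_profile[OF y] interpolate_sum ..
  also have "interpolate G L (\<lambda>w. \<Sum>v\<in>verts G. profile y v * (if w = v then 1 else 0)) y = form y y"
    unfolding form_def
    by (rule interpolate_cong[OF y])
      (simp add: if_distrib[of "\<lambda>x. _ * x"] sum.delta' cong: if_cong)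
  finally show ?thesis .
qed

lemma potential_diag_Interior:
  assumes e: "e \<in> arcs G"
  shows "potential (Interior e s) (Interior e s) = kappa e * s * (L e - s)"
    and "form (Interior e s) (Interior e s) = 2 * (s / L e) * (1 - s / L e) * r (tail G e) (head G e)"
proof -
  have V: "tail G e \<in> verts G" "head G e \<in> verts G" using e by auto
  show f: "form (Interior e s) (Interior e s) = 2 * (s / L e) * (1 - s / L e) * r (tail G e) (head G e)"
  proof -
    have "(1 - \<sigma>) * ((1 - \<sigma>) * 0 + \<sigma> * R) + \<sigma> * ((1 - \<sigma>) * R + \<sigma> * 0) = 2 * \<sigma> * (1 - \<sigma>) * R"
      for \<sigma> R :: real by algebra
    then show ?thesis
      by (simp only: form_def interpolate.simps r_diag[OF V(1)] r_diag[OF V(2)] r_sym[OF V(2,1)])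
  qed
  show "potential (Interior e s) (Interior e s) = kappa e * s * (L e - s)"
    unfolding potential_def f kappa_def using length_pos[OF e]
    by (simp add: divide_simps power2_eq_square) (simp add: algebra_simps)
qed

lemma potential_diag_Vertex: "p \<in> verts G \<Longrightarrow> potential (Vertex p) (Vertex p) = 0"
  and form_diag_Vertex: "p \<in> verts G \<Longrightarrow> form (Vertex p) (Vertex p) = 0"
  by (simp_all add: potential_def form_def r_diag)

text \<open>
  The formula for the resistance in which the dependence on \<open>x\<close> is explicit: a quadratic
  \<open>potential x x\<close>, an affine function and the kink of the Green function.
\<close>
lemma resistance_eq':
  assumes "x \<in> points G L" "y \<in> points G L"
  shows "resistance G L x y = potential x x + potential y y + interpolate G L (profile y) x -
    2 * segment_green L x y"
  using resistance_eq[OF assms] form_sym[OF assms]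
  by (simp add: potential_def[of x y] form_def)

lemma resistance_Interior:
  assumes e: "e \<in> arcs G" and s: "0 < s" "s < L e" and y: "y \<in> points G L"
  shows "resistance G L (Interior e s) y =
    (potential y y + profile y (tail G e)) +
    (kappa e * L e + (profile y (head G e) - profile y (tail G e)) / L e) * s +
    (- kappa e) * s\<^sup>2 - 2 * segment_green L (Interior e s) y"
proof -
  have "Interior e s \<in> points G L" using e s by (auto simp: points_def)
  from resistance_eq'[OF this y] show ?thesis
    using length_pos[OF e]
    by (simp add: potential_diag_Interior e power2_eq_square algebra_simps diff_divide_distrib)
qed

text \<open>
  On either side of the kink at \<open>y\<close> the resistance is a quadratic polynomial with the same leading
  coefficient.
\<close>
lemma resistance_edge_cases:
  assumes e: "e \<in> arcs G" and y: "y \<in> points G L"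
  defines "\<alpha> \<equiv> potential y y + profile y (tail G e)"
    and "\<beta> \<equiv> kappa e * L e + (profile y (head G e) - profile y (tail G e)) / L e"
  shows "(\<And>t. y \<noteq> Interior e t) \<Longrightarrow> 0 < s \<Longrightarrow> s < L e \<Longrightarrow>
      resistance G L (Interior e s) y = \<alpha> + \<beta> * s + (- kappa e) * s\<^sup>2"
    and "y = Interior e t \<Longrightarrow> 0 < s \<Longrightarrow> s < t \<Longrightarrow> 
      resistance G L (Interior e s) y = \<alpha> + (\<beta> - 2 * (1 - t / L e)) * s + (- kappa e) * s\<^sup>2"
    and "y = Interior e t \<Longrightarrow> t < s \<Longrightarrow> s < L e \<Longrightarrow>
      resistance G L (Interior e s) y = (\<alpha> - 2 * t) + (\<beta> + 2 * t / L e) * s + (- kappa e) * s\<^sup>2"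
proof -
  assume *: "\<And>t. y \<noteq> Interior e t" and s: "0 < s" "s < L e"
  have "segment_green L (Interior e s) y = 0" using * by (cases y) auto
  then show "resistance G L (Interior e s) y = \<alpha> + \<beta> * s + (- kappa e) * s\<^sup>2"
    using resistance_Interior[OF e s y] by (simp add: \<alpha>_def \<beta>_def)
next
  assume *: "y = Interior e t" and s: "0 < s" "s < t"
  then have t: "t < L e" using y by (auto simp: points_def)
  have "segment_green L (Interior e s) y = (1 - t / L e) * s"
    using * s t length_pos[OF e] by (simp add: field_simps)
  then show "resistance G L (Interior e s) y = \<alpha> + (\<beta> - 2 * (1 - t / L e)) * s + (- kappa e) * s\<^sup>2"
    using resistance_Interior[OF e s(1) _ y] s t by (simp add: \<alpha>_def \<beta>_def left_diff_distrib)
next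
  assume *: "y = Interior e t" and s: "t < s" "s < L e"
  then have t: "0 < t" using y by (auto simp: points_def)
  have "segment_green L (Interior e s) y = t - t / L e * s"
    using * s t length_pos[OF e] by (simp add: field_simps)
  then show "resistance G L (Interior e s) y = (\<alpha> - 2 * t) + (\<beta> + 2 * t / L e) * s + (- kappa e) * s\<^sup>2"
    using resistance_Interior[OF e _ s(2) y] s t by (simp add: \<alpha>_def \<beta>_def distrib_right)
qed

lemma has_bochner_integral_edge_deriv:
  assumes ab: "a \<le> b" and f: "\<And>s. a < s \<Longrightarrow> s < b \<Longrightarrow> f (Interior e s) = \<alpha> + \<beta> * s + \<gamma> * s\<^sup>2"
    and I: "I = (\<beta>\<^sup>2 * b + 2 * \<beta> * \<gamma> * b\<^sup>2 + 4 * \<gamma>\<^sup>2 * b ^ 3 / 3) -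
      (\<beta>\<^sup>2 * a + 2 * \<beta> * \<gamma> * a\<^sup>2 + 4 * \<gamma>\<^sup>2 * a ^ 3 / 3)"
  shows "has_bochner_integral lborel (\<lambda>s. indicator {a<..<b} s *\<^sub>R (edge_deriv f (Interior e s))\<^sup>2) I"
proof (rule has_bochner_integral_quadratic[OF ab, where \<alpha> = "\<beta>\<^sup>2" and \<beta> = "4 * \<beta> * \<gamma>" and \<gamma> = "4 * \<gamma>\<^sup>2"])
  fix s assume s: "a < s" "s < b"
  have "((\<lambda>s. \<alpha> + \<beta> * s + \<gamma> * s\<^sup>2) has_real_derivative \<beta> + 2 * \<gamma> * s) (at s)"
    by (auto intro!: derivative_eq_intros)
  then have "((\<lambda>s. f (Interior e s)) has_real_derivative \<beta> + 2 * \<gamma> * s) (at s)"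
    by (rule has_field_derivative_transform_within_open[where S = "{a<..<b}"]) (use s f in auto)
  then have "edge_deriv f (Interior e s) = \<beta> + 2 * \<gamma> * s"
    by (simp add: DERIV_imp_deriv)
  then show "(edge_deriv f (Interior e s))\<^sup>2 = \<beta>\<^sup>2 + 4 * \<beta> * \<gamma> * s + 4 * \<gamma>\<^sup>2 * s\<^sup>2"
    by (simp add: power2_eq_square algebra_simps)
qed (simp add: I)

lemma resistance_deriv_integral:
  assumes e: "e \<in> arcs G" and y: "y \<in> points G L"
  shows "has_bochner_integral lborel
    (\<lambda>s. indicator {0<..<L e} s *\<^sub>R (edge_deriv (\<lambda>z. resistance G L z y) (Interior e s))\<^sup>2)
    ((profile y (head G e) - profile y (tail G e))\<^sup>2 / L e + (kappa e)\<^sup>2 * L e ^ 3 / 3 +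
      (if \<exists>t. y = Interior e t then 2 * form y y else 0))"
proof -
  define D where "D = (profile y (head G e) - profile y (tail G e)) / L e"
  have L: "0 < L e" using e by (rule length_pos)
  have DL: "(profile y (head G e) - profile y (tail G e))\<^sup>2 / L e = D\<^sup>2 * L e"
    using L by (simp add: D_def power2_eq_square)
  show ?thesis
  proof (cases "\<exists>t. y = Interior e t")
    case False
    show ?thesis
      unfolding DL if_not_P[OF False]
      by (rule has_bochner_integral_edge_deriv[OF less_imp_le[OF L] resistance_edge_cases(1)[OF e y]])
        (use False L in \<open>auto simp: D_def[symmetric] power2_eq_square power3_eq_cube algebra_simps\<close>)
  next
    case True
    then obtain t where t: "y = Interior e t" by blast
    then have t0: "0 < t" "t < L e" using y by (auto simp: points_def)
    define \<tau> where "\<tau> = t / L e"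
    have t\<tau>: "t = \<tau> * L e" using L by (simp add: \<tau>_def)
    have R: "r (tail G e) (head G e) = L e - kappa e * (L e)\<^sup>2" 
      using L by (simp add: kappa_def power2_eq_square)
    have F: "form y y = 2 * \<tau> * (1 - \<tau>) * (L e - kappa e * (L e)\<^sup>2)"
      unfolding t potential_diag_Interior(2)[OF e] R \<tau>_def ..
    show ?thesis
    \<comment> \<open>The value of the integral is brought into the stated form in the last subgoal.\<close>
    proof (rule has_bochner_integral_split[OF t0, THEN arg_cong[where f = "has_bochner_integral lborel _", THEN iffD1, rotated]])
      show "has_bochner_integral lborel
        (\<lambda>s. indicator {0<..<t} s *\<^sub>R (edge_deriv (\<lambda>z. resistance G L z y) (Interior e s))\<^sup>2)
        ((kappa e * L e + D - 2 * (1 - \<tau>))\<^sup>2 * t - 2 * (kappa e * L e + D - 2 * (1 - \<tau>)) * kappa e * t\<^sup>2 +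
          4 * (kappa e)\<^sup>2 * t ^ 3 / 3)"
        by (rule has_bochner_integral_edge_deriv[OF less_imp_le[OF t0(1)] resistance_edge_cases(2)[OF e y t]])
          (use t0 in \<open>simp_all add: D_def \<tau>_def\<close>)
      show "has_bochner_integral lborel
        (\<lambda>s. indicator {t<..<L e} s *\<^sub>R (edge_deriv (\<lambda>z. resistance G L z y) (Interior e s))\<^sup>2)
        (((kappa e * L e + D + 2 * \<tau>)\<^sup>2 * L e - 2 * (kappa e * L e + D + 2 * \<tau>) * kappa e * (L e)\<^sup>2 +
          4 * (kappa e)\<^sup>2 * L e ^ 3 / 3) -
         ((kappa e * L e + D + 2 * \<tau>)\<^sup>2 * t - 2 * (kappa e * L e + D + 2 * \<tau>) * kappa e * t\<^sup>2 +
          4 * (kappa e)\<^sup>2 * t ^ 3 / 3))"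
        by (rule has_bochner_integral_edge_deriv[OF less_imp_le[OF t0(2)] resistance_edge_cases(3)[OF e y t]])
          (use t0 in \<open>simp_all add: D_def \<tau>_def\<close>)
      show "(kappa e * L e + D - 2 * (1 - \<tau>))\<^sup>2 * t - 2 * (kappa e * L e + D - 2 * (1 - \<tau>)) * kappa e * t\<^sup>2 +
          4 * (kappa e)\<^sup>2 * t ^ 3 / 3 +
          (((kappa e * L e + D + 2 * \<tau>)\<^sup>2 * L e - 2 * (kappa e * L e + D + 2 * \<tau>) * kappa e * (L e)\<^sup>2 +
          4 * (kappa e)\<^sup>2 * L e ^ 3 / 3) -
         ((kappa e * L e + D + 2 * \<tau>)\<^sup>2 * t - 2 * (kappa e * L e + D + 2 * \<tau>) * kappa e * t\<^sup>2 +
          4 * (kappa e)\<^sup>2 * t ^ 3 / 3)) =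
        (profile y (head G e) - profile y (tail G e))\<^sup>2 / L e + (kappa e)\<^sup>2 * L e ^ 3 / 3 +
          (if \<exists>t. y = Interior e t then 2 * form y y else 0)"
        unfolding DL F if_P[OF True] t\<tau>
        by (simp add: power2_eq_square power3_eq_cube algebra_simps)
    qed
  qed
qed

text \<open>
  The term \<open>form y y\<close> from the sum of the squared slopes and the one from the kink at \<open>y\<close> cancel,
  which is why \<open>y\<close> disappears.
\<close>
theorem tau_const_eq:
  assumes y: "y \<in> points G L"
  shows "tau_const G L y = rho / 2 + diagonal_energy / 12"
proof -
  have "(LINT x|length_measure G L. (edge_deriv (\<lambda>z. resistance G L z y) x)\<^sup>2) =
      (\<Sum>p\<in>verts G. 0 * (edge_deriv (\<lambda>z. resistance G L z y) (Vertex p))\<^sup>2) +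
      (\<Sum>e\<in>arcs G. 1 * ((profile y (head G e) - profile y (tail G e))\<^sup>2 / L e + (kappa e)\<^sup>2 * L e ^ 3 / 3 +
        (if \<exists>t. y = Interior e t then 2 * form y y else 0)))"
    unfolding length_measure_def
    by (rule lebesgue_integral_graph_measure; (rule resistance_deriv_integral[OF _ y] | simp))
  also have "\<dots> = (2 * rho - 2 * form y y) + diagonal_energy / 3 +
      (\<Sum>e\<in>arcs G. if \<exists>t. y = Interior e t then 2 * form y y else 0)"
    by (simp add: sum.distrib sum_profile_energy y diagonal_energy_def sum_divide_distrib)
  also have "(\<Sum>e\<in>arcs G. if \<exists>t. y = Interior e t then 2 * form y y else 0) = 2 * form y y"
  proof (cases y)
    case (Vertex p)
    then show ?thesis using y by (auto simp: form_diag_Vertex points_def)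
  next
    case (Interior e0 t)
    then have "e0 \<in> arcs G" using y by (auto simp: points_def)
    then show ?thesis by (simp add: Interior sum.delta)
  qed
  finally show ?thesis by (simp add: tau_const_def)
qed

end

section \<open>The invariants of a bridgeless polarized graph\<close>

locale bridgeless_polarized = resistance_matrix +
  fixes q :: "'a \<Rightarrow> nat"
  assumes nonempty: "verts G \<noteq> {}"
    and canonical_nonneg: "p \<in> verts G \<Longrightarrow> 0 \<le> canonical_coeff G q p"
    and genus_pos: "0 < genus G q"
    and connected_del_arc: "e \<in> arcs G \<Longrightarrow> Digraph_Component.connected (del_arc e)"
    and r_less_length: "e \<in> arcs G \<Longrightarrow> r (tail G e) (head G e) < L e"
begin

abbreviation K :: "'a \<Rightarrow> real" where "K p \<equiv> real_of_int (canonical_coeff G q p)"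
abbreviation g :: real where "g \<equiv> real_of_int (genus G q)"

lemma g_pos: "0 < g" using genus_pos by simp

lemma r_nonneg: "p \<in> verts G \<Longrightarrow> p' \<in> verts G \<Longrightarrow> 0 \<le> r p p'"
  using resistance_nonneg[of "Vertex p" "Vertex p'"] resistance_vertices[of p p']
  by (simp add: points_def)

lemma kappa_length: "e \<in> arcs G \<Longrightarrow> kappa e * L e = 1 - r (tail G e) (head G e) / L e"
  using length_pos[of e] by (simp add: kappa_def power2_eq_square divide_simps)

lemma kappa_nonneg: "e \<in> arcs G \<Longrightarrow> 0 \<le> kappa e"
  using r_less_length[of e] by (simp add: kappa_def)

text \<open>
  After multiplication by \<open>g\<close>, half of the admissible mass on the edges at a vertex together with
  the mass \<open>q\<close> is half of the canonical divisor plus the equilibrium mass. This is what turns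
  integrals against the admissible measure into the sums defining \<open>theta_inv\<close>.
\<close>
lemma sum_kappa_vertex:
  assumes v: "v \<in> verts G"
  shows "(\<Sum>e\<in>out_arcs G v. kappa e * L e) + (\<Sum>e\<in>in_arcs G v. kappa e * L e) =
    K v - 2 * real (q v) + 2 * c v"
proof -
  have "(\<Sum>e\<in>out_arcs G v. kappa e * L e) =
      (\<Sum>e\<in>out_arcs G v. 1 + (r v (tail G e) - r v (head G e)) / L e)"
    by (rule sum.cong) (use v in \<open>auto simp: kappa_length r_diag\<close>)
  moreover have "(\<Sum>e\<in>in_arcs G v. kappa e * L e) =
      (\<Sum>e\<in>in_arcs G v. 1 - (r v (tail G e) - r v (head G e)) / L e)"
    by (rule sum.cong) (use v r_sym in \<open>auto simp: kappa_length r_diag\<close>)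
  ultimately show ?thesis
    using laplacian_r[OF v v]
    by (simp add: laplacian_def sum.distrib sum_subtractf canonical_coeff_def valence_def
        out_degree_def in_degree_def)
qed

lemma sum_kappa_ends:
  "(\<Sum>v\<in>verts G. real (q v) * f v) + (\<Sum>e\<in>arcs G. kappa e * (L e * (f (tail G e) + f (head G e)) / 2)) =
    (\<Sum>v\<in>verts G. K v * f v) / 2 + (\<Sum>v\<in>verts G. c v * f v)"
proof -
  have "(\<Sum>e\<in>arcs G. kappa e * (L e * (f (tail G e) + f (head G e)) / 2)) =
      (\<Sum>e\<in>arcs G. kappa e * L e * f (tail G e)) / 2 + (\<Sum>e\<in>arcs G. kappa e * L e * f (head G e)) / 2"
    unfolding sum_divide_distrib sum.distrib[symmetric] by (rule sum.cong) (simp_all add: algebra_simps)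
  also have "(\<Sum>e\<in>arcs G. kappa e * L e * f (tail G e)) =
      (\<Sum>v\<in>verts G. f v * (\<Sum>e\<in>out_arcs G v. kappa e * L e))"
    unfolding sum_arcs_by_tail[symmetric] sum_distrib_left by (intro sum.cong refl) auto
  also have "(\<Sum>e\<in>arcs G. kappa e * L e * f (head G e)) =
      (\<Sum>v\<in>verts G. f v * (\<Sum>e\<in>in_arcs G v. kappa e * L e))"
    unfolding sum_arcs_by_head[symmetric] sum_distrib_left by (intro sum.cong refl) auto
  also have "(\<Sum>v\<in>verts G. f v * (\<Sum>e\<in>out_arcs G v. kappa e * L e)) / 2 +
      (\<Sum>v\<in>verts G. f v * (\<Sum>e\<in>in_arcs G v. kappa e * L e)) / 2 =
      (\<Sum>v\<in>verts G. f v * (K v - 2 * real (q v) + 2 * c v)) / 2"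
    unfolding add_divide_distrib[symmetric] sum.distrib[symmetric] distrib_left[symmetric]
    by (simp add: sum_kappa_vertex)
  also have "\<dots> = (\<Sum>v\<in>verts G. K v * f v) / 2 + (\<Sum>v\<in>verts G. c v * f v) - (\<Sum>v\<in>verts G. real (q v) * f v)"
    unfolding sum_divide_distrib sum.distrib[symmetric] sum_subtractf[symmetric]
    by (rule sum.cong) (simp_all add: field_simps)
  finally show ?thesis by simp
qed

lemma sum_K: "(\<Sum>v\<in>verts G. K v) = 2 * g - 2"
proof -
  have "(\<Sum>v\<in>verts G. real (out_degree G v)) = real (card (arcs G))"
    "(\<Sum>v\<in>verts G. real (in_degree G v)) = real (card (arcs G))"
    using sum_arcs_by_tail[of "\<lambda>_. 1 :: real"] sum_arcs_by_head[of "\<lambda>_. 1 :: real"]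
    by (simp_all add: out_degree_def in_degree_def)
  then show ?thesis
    by (simp add: canonical_coeff_def valence_def genus_def betti_def sum.distrib sum_subtractf
        sum_distrib_left)
qed

text \<open>
  Foster's theorem.
\<close>
lemma total_admissible_mass: "(\<Sum>v\<in>verts G. real (q v)) + (\<Sum>e\<in>arcs G. kappa e * L e) = g"
proof -
  have "(\<Sum>v\<in>verts G. c v) = 1" using nonempty sum_c by auto
  then show ?thesis using sum_kappa_ends[of "\<lambda>_. 1"] sum_K by (simp add: diff_divide_distrib)
qed

lemma admissible_density:
  assumes e: "e \<in> arcs G"
  shows "1 / (ennreal (L e) + deletion_resistance G L e) / ennreal g = ennreal (kappa e / g)"
proof -
  let ?R = "r (tail G e) (head G e)"
  have L: "0 < L e" and R: "0 \<le> ?R" "?R < L e"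
    using e by (auto simp: length_pos r_nonneg r_less_length)
  have D: "deletion_resistance G L e = ennreal (L e * ?R / (L e - ?R))"
    unfolding deletion_resistance_def Let_def
    using connected_del_arc[OF e] resistance_del_arc[OF e R(2)] by simp
  have sum: "L e + L e * ?R / (L e - ?R) = 1 / kappa e"
    using L R by (simp add: kappa_def power2_eq_square divide_simps) (simp add: algebra_simps)
  have k: "0 < kappa e" using L R by (simp add: kappa_def)
  have "ennreal (L e) + deletion_resistance G L e = ennreal (1 / kappa e)"
    unfolding D sum[symmetric] using L R by (intro ennreal_plus[symmetric]) auto
  moreover have "1 / ennreal (1 / kappa e) = ennreal (kappa e)"
    using divide_ennreal[of 1 "1 / kappa e"] k by simp
  moreover have "ennreal (kappa e) / ennreal g = ennreal (kappa e / g)"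
    using k g_pos by (intro divide_ennreal) auto
  ultimately show ?thesis by simp
qed

lemma integral_admissible_measure:
  assumes f: "\<And>x. x \<in> points G L \<Longrightarrow> 0 \<le> f x"
    and I: "\<And>e. e \<in> arcs G \<Longrightarrow>
      has_bochner_integral lborel (\<lambda>t. indicator {0<..<L e} t *\<^sub>R f (Interior e t)) (I e)"
  shows "(LINT x|admissible_measure G L q. f x) =
    ((\<Sum>p\<in>verts G. real (q p) * f (Vertex p)) + (\<Sum>e\<in>arcs G. kappa e * I e)) / g"
proof -
  have m: "of_nat (q p) / ennreal g = ennreal (real (q p) / g)" for p
    using g_pos divide_ennreal[of "real (q p)" g] by (simp add: ennreal_of_nat_eq_real_of_nat)
  have "(LINT x|admissible_measure G L q. f x) =
      (\<Sum>p\<in>verts G. real (q p) / g * f (Vertex p)) + (\<Sum>e\<in>arcs G. kappa e / g * I e)"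
    unfolding admissible_measure_def
    by (rule lebesgue_integral_graph_measure)
      (use f I g_pos in \<open>auto simp: m admissible_density kappa_nonneg\<close>)
  then show ?thesis by (simp add: add_divide_distrib sum_divide_distrib)
qed

lemma integral_resistance_edge:
  assumes e: "e \<in> arcs G" and y: "y \<in> points G L"
  shows "has_bochner_integral lborel
    (\<lambda>s. indicator {0<..<L e} s *\<^sub>R resistance G L (Interior e s) y)
    (kappa e * L e ^ 3 / 6 + L e * potential y y + L e * (profile y (tail G e) + profile y (head G e)) / 2 -
      (case y of Vertex p \<Rightarrow> 0 | Interior e' t \<Rightarrow> if e = e' then t * (L e - t) else 0))"
proof -
  define D where "D = (profile y (head G e) - profile y (tail G e)) / L e"
  have L: "0 < L e" using e by (rule length_pos)
  have H: "profile y (head G e) = profile y (tail G e) + D * L e" using L by (simp add: D_def)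
  show ?thesis
  proof (cases "\<exists>t. y = Interior e t")
    case False
    then have z: "(case y of Vertex p \<Rightarrow> 0 | Interior e' t \<Rightarrow> if e = e' then t * (L e - t) else 0) = 0"
      by (auto split: point.splits)
    show ?thesis
      unfolding H z
      by (rule has_bochner_integral_quadratic[OF less_imp_le[OF L] resistance_edge_cases(1)[OF e y]])
        (use False L in \<open>auto simp: D_def[symmetric] power2_eq_square power3_eq_cube algebra_simps
          add_divide_distrib\<close>)
  next
    case True
    then obtain t where t: "y = Interior e t" by blast
    then have t0: "0 < t" "t < L e" using y by (auto simp: points_def)
    define \<tau> where "\<tau> = t / L e"
    have t\<tau>: "t = \<tau> * L e" using L by (simp add: \<tau>_def)
    have z: "(case y of Vertex p \<Rightarrow> 0 | Interior e' t \<Rightarrow> if e = e' then t * (L e - t) else 0) = t * (L e - t)"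
      by (simp add: t)
    let ?\<alpha> = "potential y y + profile y (tail G e)" and ?\<beta> = "kappa e * L e + D"
    show ?thesis
    \<comment> \<open>The value of the integral is brought into the stated form in the last subgoal.\<close>
    proof (rule has_bochner_integral_split[OF t0, THEN arg_cong[where f = "has_bochner_integral lborel _", THEN iffD1, rotated]])
      show "has_bochner_integral lborel
        (\<lambda>s. indicator {0<..<t} s *\<^sub>R resistance G L (Interior e s) y)
        (?\<alpha> * t + (?\<beta> - 2 * (1 - \<tau>)) * t\<^sup>2 / 2 - kappa e * t ^ 3 / 3)"
        by (rule has_bochner_integral_quadratic[OF less_imp_le[OF t0(1)] resistance_edge_cases(2)[OF e y t]])
          (use t0 in \<open>simp_all add: D_def \<tau>_def\<close>)
      show "has_bochner_integral lborel
        (\<lambda>s. indicator {t<..<L e} s *\<^sub>R resistance G L (Interior e s) y)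
        (((?\<alpha> - 2 * t) * L e + (?\<beta> + 2 * \<tau>) * (L e)\<^sup>2 / 2 - kappa e * L e ^ 3 / 3) -
         ((?\<alpha> - 2 * t) * t + (?\<beta> + 2 * \<tau>) * t\<^sup>2 / 2 - kappa e * t ^ 3 / 3))"
        by (rule has_bochner_integral_quadratic[OF less_imp_le[OF t0(2)] resistance_edge_cases(3)[OF e y t]])
          (use t0 in \<open>simp_all add: D_def \<tau>_def\<close>)
      show "(?\<alpha> * t + (?\<beta> - 2 * (1 - \<tau>)) * t\<^sup>2 / 2 - kappa e * t ^ 3 / 3) +
         (((?\<alpha> - 2 * t) * L e + (?\<beta> + 2 * \<tau>) * (L e)\<^sup>2 / 2 - kappa e * L e ^ 3 / 3) -
         ((?\<alpha> - 2 * t) * t + (?\<beta> + 2 * \<tau>) * t\<^sup>2 / 2 - kappa e * t ^ 3 / 3)) =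
         kappa e * L e ^ 3 / 6 + L e * potential y y + L e * (profile y (tail G e) + profile y (head G e)) / 2 -
        (case y of Vertex p \<Rightarrow> 0 | Interior e' t \<Rightarrow> if e = e' then t * (L e - t) else 0)"
        unfolding z H t\<tau>
        by (simp add: power2_eq_square power3_eq_cube algebra_simps add_divide_distrib diff_divide_distrib)
    qed
  qed
qed

lemma resistance_Vertex_left:
  assumes p: "p \<in> verts G" and y: "y \<in> points G L"
  shows "resistance G L (Vertex p) y = potential y y + profile y p"
  using resistance_eq'[of "Vertex p" y] assms by (simp add: points_def potential_diag_Vertex)

text \<open>
  Integrating the kink of the Green function over the edge through \<open>y\<close> removes exactly one of the \<open>g\<close>
  copies of \<open>potential y y\<close>.
\<close>
lemma integral_resistance_admissible:
  assumes y: "y \<in> points G L"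
  shows "(LINT x|admissible_measure G L q. resistance G L x y) =
    ((\<Sum>p\<in>verts G. K p * profile y p) / 2 + rho + diagonal_energy / 6 + (g - 1) * potential y y) / g"
proof -
  let ?corr = "\<lambda>e. case y of Vertex p \<Rightarrow> 0 | Interior e' t \<Rightarrow> if e = e' then t * (L e - t) else 0"
  have corr: "(\<Sum>e\<in>arcs G. kappa e * ?corr e) = potential y y"
  proof (cases y)
    case (Vertex p)
    then show ?thesis using y by (auto simp: potential_diag_Vertex points_def)
  next
    case (Interior e t)
    then have "e \<in> arcs G" using y by (auto simp: points_def)
    then show ?thesis
      by (simp add: Interior potential_diag_Interior if_distrib[of "\<lambda>x. _ * x"] sum.delta
          mult.assoc cong: if_cong)
  qed
  have "(LINT x|admissible_measure G L q. resistance G L x y) =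
      ((\<Sum>p\<in>verts G. real (q p) * resistance G L (Vertex p) y) +
       (\<Sum>e\<in>arcs G. kappa e * (kappa e * L e ^ 3 / 6 + L e * potential y y +
          L e * (profile y (tail G e) + profile y (head G e)) / 2 - ?corr e))) / g"
    using y by (intro integral_admissible_measure resistance_nonneg integral_resistance_edge)
  also have "(\<Sum>p\<in>verts G. real (q p) * resistance G L (Vertex p) y) =
      potential y y * (\<Sum>p\<in>verts G. real (q p)) + (\<Sum>p\<in>verts G. real (q p) * profile y p)"
    unfolding sum_distrib_left sum.distrib[symmetric]
    by (rule sum.cong) (simp_all add: resistance_Vertex_left y algebra_simps)
  also have "(\<Sum>e\<in>arcs G. kappa e * (kappa e * L e ^ 3 / 6 + L e * potential y y +
          L e * (profile y (tail G e) + profile y (head G e)) / 2 - ?corr e)) =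
      diagonal_energy / 6 + potential y y * (\<Sum>e\<in>arcs G. kappa e * L e) +
      (\<Sum>e\<in>arcs G. kappa e * (L e * (profile y (tail G e) + profile y (head G e)) / 2)) -
      (\<Sum>e\<in>arcs G. kappa e * ?corr e)"
    unfolding diagonal_energy_def sum_distrib_left sum_divide_distrib sum.distrib[symmetric] sum_subtractf[symmetric]
    by (rule sum.cong) (simp_all add: power2_eq_square algebra_simps)
  finally have "(LINT x|admissible_measure G L q. resistance G L x y) =
      (potential y y * ((\<Sum>v\<in>verts G. real (q v)) + (\<Sum>e\<in>arcs G. kappa e * L e)) +
       ((\<Sum>p\<in>verts G. real (q p) * profile y p) +
        (\<Sum>e\<in>arcs G. kappa e * (L e * (profile y (tail G e) + profile y (head G e)) / 2))) +
       diagonal_energy / 6 - potential y y) / g"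
    unfolding corr by (simp add: algebra_simps)
  then show ?thesis
    unfolding total_admissible_mass sum_kappa_ends[of "profile y"] sum_c_profile[OF y] by (simp add: algebra_simps)
qed

lemma integral_resistance_canonical:
  assumes y: "y \<in> points G L"
  shows "(LINT x|canonical_measure G L q. resistance G L x y) =
    (\<Sum>p\<in>verts G. K p * profile y p) + (2 * g - 2) * potential y y"
proof -
  have "(LINT x|canonical_measure G L q. resistance G L x y) =
      (\<Sum>p\<in>verts G. K p * resistance G L (Vertex p) y) +
      (\<Sum>e\<in>arcs G. 0 * (kappa e * L e ^ 3 / 6 + L e * potential y y +
          L e * (profile y (tail G e) + profile y (head G e)) / 2 -
          (case y of Vertex p \<Rightarrow> 0 | Interior e' t \<Rightarrow> if e = e' then t * (L e - t) else 0)))"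
    unfolding canonical_measure_def
    by (rule lebesgue_integral_graph_measure;
        (rule integral_resistance_edge resistance_nonneg; assumption?; rule y)?;
        simp add: canonical_nonneg)
  also have "\<dots> = (\<Sum>p\<in>verts G. K p * profile y p + K p * potential y y)"
    by (simp add: resistance_Vertex_left y algebra_simps)
  finally show ?thesis
    unfolding sum.distrib sum_distrib_right[symmetric] sum_K .
qed

text \<open>
  The inner integrals over both measures have the form treated here, with \<open>\<psi>\<close> a multiple of
  \<open>canonical_potential\<close>.
\<close>
lemma integral_interpolate_edge:
  assumes e: "e \<in> arcs G"
    and f: "\<And>x. x \<in> points G L \<Longrightarrow> f x = interpolate G L \<psi> x + \<alpha> + \<beta> * potential x x"
  shows "has_bochner_integral lborel (\<lambda>t. indicator {0<..<L e} t *\<^sub>R f (Interior e t))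
    (L e * (\<psi> (tail G e) + \<psi> (head G e)) / 2 + \<alpha> * L e + \<beta> * (kappa e * L e ^ 3 / 6))"
proof -
  define D where "D = (\<psi> (head G e) - \<psi> (tail G e)) / L e"
  have L: "0 < L e" using e by (rule length_pos)
  have H: "\<psi> (head G e) = \<psi> (tail G e) + D * L e" using L by (simp add: D_def)
  show ?thesis
  proof (rule has_bochner_integral_quadratic[OF less_imp_le[OF L],
        where \<alpha> = "\<psi> (tail G e) + \<alpha>" and \<beta> = "D + \<beta> * kappa e * L e" and \<gamma> = "- \<beta> * kappa e"])
    fix s assume s: "0 < s" "s < L e"
    have "(1 - s / L e) * \<psi> (tail G e) + s / L e * \<psi> (head G e) = \<psi> (tail G e) + D * s"
      unfolding H using L by (simp add: field_simps)
    then show "f (Interior e s) = \<psi> (tail G e) + \<alpha> + (D + \<beta> * kappa e * L e) * s + - \<beta> * kappa e * s\<^sup>2"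
      using f[of "Interior e s"] e s
      by (simp add: points_def potential_diag_Interior power2_eq_square algebra_simps)
  qed (simp add: H power2_eq_square power3_eq_cube algebra_simps add_divide_distrib)
qed

lemma integral_interpolate_admissible:
  assumes f0: "\<And>x. x \<in> points G L \<Longrightarrow> 0 \<le> f x"
    and f: "\<And>x. x \<in> points G L \<Longrightarrow> f x = interpolate G L \<psi> x + \<alpha> + \<beta> * potential x x"
  shows "(LINT x|admissible_measure G L q. f x) =
    ((\<Sum>p\<in>verts G. K p * \<psi> p) / 2 + (\<Sum>p\<in>verts G. c p * \<psi> p) + \<alpha> * g + \<beta> * diagonal_energy / 6) / g"
proof -
  have "(LINT x|admissible_measure G L q. f x) =
      ((\<Sum>p\<in>verts G. real (q p) * f (Vertex p)) +
       (\<Sum>e\<in>arcs G. kappa e * (L e * (\<psi> (tail G e) + \<psi> (head G e)) / 2 + \<alpha> * L e + \<beta> * (kappa e * L e ^ 3 / 6)))) / g"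
    by (intro integral_admissible_measure integral_interpolate_edge f0 f)
  also have "(\<Sum>p\<in>verts G. real (q p) * f (Vertex p)) =
      (\<Sum>p\<in>verts G. real (q p) * \<psi> p) + \<alpha> * (\<Sum>p\<in>verts G. real (q p))"
    unfolding sum_distrib_left sum.distrib[symmetric]
    by (rule sum.cong) (simp_all add: f points_def potential_diag_Vertex algebra_simps)
  also have "(\<Sum>e\<in>arcs G. kappa e * (L e * (\<psi> (tail G e) + \<psi> (head G e)) / 2 + \<alpha> * L e + \<beta> * (kappa e * L e ^ 3 / 6))) =
      (\<Sum>e\<in>arcs G. kappa e * (L e * (\<psi> (tail G e) + \<psi> (head G e)) / 2)) +
      \<alpha> * (\<Sum>e\<in>arcs G. kappa e * L e) + \<beta> * diagonal_energy / 6"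
    unfolding diagonal_energy_def sum_distrib_left sum_divide_distrib sum.distrib[symmetric]
    by (rule sum.cong) (simp_all add: power2_eq_square algebra_simps)
  finally have "(LINT x|admissible_measure G L q. f x) =
      (((\<Sum>p\<in>verts G. real (q p) * \<psi> p) +
        (\<Sum>e\<in>arcs G. kappa e * (L e * (\<psi> (tail G e) + \<psi> (head G e)) / 2))) +
       \<alpha> * ((\<Sum>v\<in>verts G. real (q v)) + (\<Sum>e\<in>arcs G. kappa e * L e)) + \<beta> * diagonal_energy / 6) / g"
    by (simp add: algebra_simps)
  then show ?thesis unfolding total_admissible_mass sum_kappa_ends .
qed

definition canonical_potential :: "'a \<Rightarrow> real" where
  "canonical_potential v = (\<Sum>p\<in>verts G. K p * r v p)"

lemma sum_K_profile: "(\<Sum>p\<in>verts G. K p * profile y p) = interpolate G L canonical_potential y"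
  unfolding canonical_potential_def[abs_def] by (simp add: interpolate_sum interpolate_linear)

lemma theta_inv_eq: "theta_inv G L q = (\<Sum>p\<in>verts G. K p * canonical_potential p)"
  by (simp add: theta_inv_def canonical_potential_def resistance_vertices sum_distrib_left mult.assoc)

lemma sum_c_canonical_potential:
  "(\<Sum>v\<in>verts G. c v * canonical_potential v) = (2 * g - 2) * rho"
proof -
  have "(\<Sum>v\<in>verts G. c v * canonical_potential v) =
      (\<Sum>v\<in>verts G. \<Sum>p\<in>verts G. K p * (c v * r p v))"
    unfolding canonical_potential_def sum_distrib_left
    by (intro sum.cong refl) (simp add: r_sym)
  also have "\<dots> = (\<Sum>p\<in>verts G. K p * (\<Sum>v\<in>verts G. c v * r p v))"
    unfolding sum_distrib_left by (rule sum.swap)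
  also have "\<dots> = (\<Sum>p\<in>verts G. K p * rho)" by (simp add: sum_c_r)
  finally show ?thesis unfolding sum_distrib_right[symmetric] sum_K .
qed

text \<open>
  The invariants \<open>\<epsilon>\<close> and \<open>Z\<close> are combinations of \<open>\<theta>\<close> and \<open>\<tau>\<close>: the numbers \<open>rho\<close> and \<open>diagonal_energy\<close> enter only
  in the ratio in which they form the tau constant.
\<close>
theorem epsilon_inv_eq:
  assumes y: "y \<in> points G L"
  shows "epsilon_inv G L q = (theta_inv G L q / 2 + 4 * (g - 1) * tau_const G L y) / g"
proof -
  have "epsilon_inv G L q =
      (theta_inv G L q / 2 + (2 * g - 2) * rho + 0 * g + (2 * g - 2) * diagonal_energy / 6) / g"
    unfolding epsilon_inv_def theta_inv_eq sum_c_canonical_potential[symmetric]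
  proof (rule integral_interpolate_admissible)
    fix x assume x: "x \<in> points G L"
    show "(LINT z|canonical_measure G L q. resistance G L z x) =
        interpolate G L canonical_potential x + 0 + (2 * g - 2) * potential x x"
      by (simp add: integral_resistance_canonical[OF x] sum_K_profile)
    show "0 \<le> (LINT z|canonical_measure G L q. resistance G L z x)"
      by (rule Bochner_Integration.integral_nonneg)
        (simp add: resistance_nonneg x canonical_measure_def space_graph_measure)
  qed
  then show ?thesis unfolding tau_const_eq[OF y] by (simp add: field_simps)
qed

theorem Z_inv_eq:
  assumes y: "y \<in> points G L"
  shows "Z_inv G L q = (theta_inv G L q / 4 + 2 * (2 * g - 1) * tau_const G L y) / (2 * g\<^sup>2)"
proof -
  have "(LINT y|admissible_measure G L q. LINT x|admissible_measure G L q. resistance G L x y) =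
      ((\<Sum>p\<in>verts G. K p * (canonical_potential p / (2 * g))) / 2 +
       (\<Sum>p\<in>verts G. c p * (canonical_potential p / (2 * g))) +
       (rho + diagonal_energy / 6) / g * g + (g - 1) / g * diagonal_energy / 6) / g"
  proof (rule integral_interpolate_admissible)
    fix x assume x: "x \<in> points G L"
    show "(LINT z|admissible_measure G L q. resistance G L z x) =
        interpolate G L (\<lambda>p. canonical_potential p / (2 * g)) x + (rho + diagonal_energy / 6) / g +
        (g - 1) / g * potential x x"
      using interpolate_linear(4)[of G L canonical_potential "1 / (2 * g)" x]
      by (simp add: integral_resistance_admissible[OF x] sum_K_profile add_divide_distrib)
    show "0 \<le> (LINT z|admissible_measure G L q. resistance G L z x)"
      by (rule Bochner_Integration.integral_nonneg)
        (simp add: resistance_nonneg x admissible_measure_def space_graph_measure)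
  qed
  also have "(\<Sum>p\<in>verts G. K p * (canonical_potential p / (2 * g))) = theta_inv G L q / (2 * g)"
    by (simp add: theta_inv_eq sum_divide_distrib)
  also have "(\<Sum>p\<in>verts G. c p * (canonical_potential p / (2 * g))) = (2 * g - 2) * rho / (2 * g)"
    by (simp add: sum_c_canonical_potential[symmetric] sum_divide_distrib)
  finally show ?thesis
    unfolding Z_inv_def tau_const_eq[OF y] using g_pos
    by (simp add: divide_simps power2_eq_square) (simp add: algebra_simps)
qed

end

section \<open>Types of points\<close>

lemma (in wf_digraph) connected_iff:
  "Digraph_Component.connected G \<longleftrightarrow>
    verts G \<noteq> {} \<and> (\<forall>u\<in>verts G. \<forall>v\<in>verts G. (u, v) \<in> (parcs (mk_symmetric G))\<^sup>*)"
proof -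
  interpret S: pair_wf_digraph "mk_symmetric G" by (rule wellformed_mk_symmetric)
  have "u \<rightarrow>\<^sup>*\<^bsub>mk_symmetric G\<^esub> v \<longleftrightarrow> (u, v) \<in> (parcs (mk_symmetric G))\<^sup>*" if "u \<in> verts G" for u v
    using S.reachable_conv'[of u v] that by simp
  then show ?thesis
    by (auto simp: connected_def strongly_connected_def)
qed

lemma sym_parcs_mk_symmetric: "sym (parcs (mk_symmetric G))"
  by (auto simp: sym_def parcs_mk_symmetric)

lemma (in wf_digraph) connected_del_arc_imp:
  assumes "Digraph_Component.connected (del_arc e)"
  shows "Digraph_Component.connected G"
proof -
  interpret D: wf_digraph "del_arc e" by unfold_locales auto
  have "parcs (mk_symmetric (del_arc e)) \<subseteq> parcs (mk_symmetric G)"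
    by (auto simp: parcs_mk_symmetric)
  from rtrancl_mono[OF this] show ?thesis
    using assms unfolding connected_iff D.connected_iff by auto
qed

text \<open>
  Cutting \<open>e\<close> at an interior point is deleting \<open>e\<close> and attaching a pendant edge at each of its end
  points.
\<close>
lemma (in wf_digraph) connected_cut_graph:
  assumes e: "e \<in> arcs G" and conn: "Digraph_Component.connected (del_arc e)"
  shows "Digraph_Component.connected (cut_graph G e)"
proof -
  interpret D: wf_digraph "del_arc e" by unfold_locales auto
  interpret C: wf_digraph "cut_graph G e"
    by unfold_locales (use e in \<open>auto simp: cut_graph_def split: if_splits\<close>)
  let ?R = "parcs (mk_symmetric (cut_graph G e))"
  have step: "(Inl x, Inl y) \<in> ?R" if "(x, y) \<in> parcs (mk_symmetric (del_arc e))" for x y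
    using that by (fastforce simp: parcs_mk_symmetric cut_graph_def)
  have "(Inl x, Inl y) \<in> ?R\<^sup>*" if "(x, y) \<in> (parcs (mk_symmetric (del_arc e)))\<^sup>*" for x y
    using that by induction (auto dest: step)
  then have Inl: "(Inl (tail G e), Inl y) \<in> ?R\<^sup>*" if "y \<in> verts G" for y
    using conn e that unfolding D.connected_iff by simp
  have "(Inl (tail G e), Inr False) \<in> ?R" "(Inl (head G e), Inr True) \<in> ?R"
    by (force simp: parcs_mk_symmetric cut_graph_def)+
  then have "(Inl (tail G e), Inr b) \<in> ?R\<^sup>*" for b
    using Inl[of "head G e"] e by (cases b) (auto intro: rtrancl_into_rtrancl)
  then have root: "(Inl (tail G e), z) \<in> ?R\<^sup>*" if "z \<in> verts (cut_graph G e)" for z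
    using that Inl by (auto simp: cut_graph_def)
  have "(z, Inl (tail G e)) \<in> ?R\<^sup>*" if "z \<in> verts (cut_graph G e)" for z
    using symD[OF sym_rtrancl[OF sym_parcs_mk_symmetric] root[OF that]] .
  with root have "(y, z) \<in> ?R\<^sup>*" if "y \<in> verts (cut_graph G e)" "z \<in> verts (cut_graph G e)" for y z
    using that by (blast intro: rtrancl_trans)
  moreover have "verts (cut_graph G e) \<noteq> {}" by (simp add: cut_graph_def)
  ultimately show ?thesis unfolding C.connected_iff by blast
qed

context metrized
begin

lemma delta_inv_0:
  assumes conn: "\<And>e. e \<in> arcs G \<Longrightarrow> Digraph_Component.connected (del_arc e)"
  shows "delta_inv G L q 0 = total_length G L"
proof -
  have "edge_type G q e 0" if "e \<in> arcs G" for e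
    using connected_cut_graph[OF that conn[OF that]] by (simp add: edge_type_def Let_def)
  then have E: "{t \<in> {0<..<L e}. Interior e t \<in> type_points G L q 0} = {0<..<L e}" if "e \<in> arcs G" for e
    using that by (auto simp: type_points_def)
  have length: "emeasure lborel {0<..<L e} = ennreal (L e)" if "e \<in> arcs G" for e
    using length_pos[OF that] by simp
  have T: "type_points G L q 0 \<in> graph_sets G L"
    using E by (auto simp: graph_sets_def) (auto simp: type_points_def points_def)
  have "emeasure (length_measure G L) (type_points G L q 0) = (\<Sum>e\<in>arcs G. ennreal (L e))"
    unfolding length_measure_def emeasure_graph_measure[OF T]
    by (simp only: mult_zero_left sum.neutral_const add_0 mult_1 E length cong: sum.cong)
  also have "\<dots> = ennreal (total_length G L)"
    using length_pos by (simp add: total_length_def sum_ennreal less_imp_le)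
  finally show ?thesis
    using length_pos by (simp add: delta_inv_def measure_def total_length_def sum_nonneg less_imp_le)
qed

lemma delta_inv_pos:
  assumes conn: "\<And>e. e \<in> arcs G \<Longrightarrow> Digraph_Component.connected (del_arc e)" and "i \<noteq> 0"
  shows "delta_inv G L q i = 0"
proof -
  have "\<not> edge_type G q e i" if "e \<in> arcs G" for e
    using connected_cut_graph[OF that conn[OF that]] \<open>i \<noteq> 0\<close> by (simp add: edge_type_def Let_def)
  then have "type_points G L q i = {}" by (auto simp: type_points_def)
  then show ?thesis by (simp add: delta_inv_def)
qed

end

section \<open>The tetrahedron\<close>

lemma UNIV_tetra_vertex: "UNIV = {VP, VQ, VR, VS}"
  using tetra_vertex.exhaust by auto

lemma UNIV_tetra_edge: "UNIV = {PQ, PR, PS, QR, QS, RS}"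
  using tetra_edge.exhaust by auto

lemma tetra_simps [simp]:
  "verts tetrahedral_graph = UNIV" "arcs tetrahedral_graph = UNIV"
  "tail tetrahedral_graph = tetra_tail" "head tetrahedral_graph = tetra_head"
  by (simp_all add: tetrahedral_graph_def)

lemma finite_tetra [simp]: "finite (UNIV :: tetra_vertex set)" "finite (UNIV :: tetra_edge set)"
  by (simp_all add: UNIV_tetra_vertex UNIV_tetra_edge)

lemma out_arcs_tetra:
  "out_arcs tetrahedral_graph VP = {PQ, PR, PS}" "out_arcs tetrahedral_graph VQ = {QR, QS}"
  "out_arcs tetrahedral_graph VR = {RS}" "out_arcs tetrahedral_graph VS = {}"
  unfolding out_arcs_def tetra_simps UNIV_tetra_edge by auto

lemma in_arcs_tetra:
  "in_arcs tetrahedral_graph VP = {}" "in_arcs tetrahedral_graph VQ = {PQ}"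
  "in_arcs tetrahedral_graph VR = {PR, QR}" "in_arcs tetrahedral_graph VS = {PS, QS, RS}"
  unfolding in_arcs_def tetra_simps UNIV_tetra_edge by auto

lemma fin_digraph_tetra: "fin_digraph tetrahedral_graph"
  by unfold_locales auto

lemma connected_tetra_del_arc: "Digraph_Component.connected (pre_digraph.del_arc tetrahedral_graph e)"
proof -
  interpret T: fin_digraph tetrahedral_graph by (rule fin_digraph_tetra)
  interpret D: wf_digraph "pre_digraph.del_arc tetrahedral_graph e"
    by unfold_locales (auto simp: T.del_arc_simps)
  let ?R = "parcs (mk_symmetric (pre_digraph.del_arc tetrahedral_graph e))"
  have R: "(x, y) \<in> ?R \<longleftrightarrow> (\<exists>e'\<in>{PQ, PR, PS, QR, QS, RS}. e' \<noteq> e \<and>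
      (x = tetra_tail e' \<and> y = tetra_head e' \<or> x = tetra_head e' \<and> y = tetra_tail e'))" for x y
    unfolding UNIV_tetra_edge[symmetric] by (auto simp: parcs_mk_symmetric T.del_arc_simps)
  have "(x, y) \<in> ?R \<or> (\<exists>w\<in>{VP, VQ, VR, VS}. (x, w) \<in> ?R \<and> (w, y) \<in> ?R)" for x y
    unfolding R by (cases x; cases y; cases e; auto)
  then have "(x, y) \<in> ?R\<^sup>*" for x y
    by (metis r_into_rtrancl rtrancl_into_rtrancl)
  then show ?thesis
    unfolding D.connected_iff by (simp add: T.del_arc_simps)
qed

lemma canonical_coeff_tetra: "canonical_coeff tetrahedral_graph (\<lambda>_. 0) p = 1"
  by (cases p) (simp_all add: canonical_coeff_def valence_def out_degree_def in_degree_def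
      out_arcs_tetra in_arcs_tetra)

lemma genus_tetra: "genus tetrahedral_graph (\<lambda>_. 0) = 3"
  by (simp add: genus_def betti_def UNIV_tetra_vertex UNIV_tetra_edge)

text \<open>
  The generating polynomial of the complements of the spanning trees; it is the denominator \<open>C\<close> of
  the theorem.
\<close>
definition tree_poly :: "(tetra_edge \<Rightarrow> real) \<Rightarrow> real" where
  "tree_poly L = L PQ*L PR*L QR + L PQ*L PS*L QR + L PR*L PS*L QR + L PQ*L PR*L QS + L PQ*L PS*L QS
     + L PR*L PS*L QS + L PR*L QR*L QS + L PS*L QR*L QS + L PQ*L PR*L RS + L PQ*L PS*L RS
     + L PR*L PS*L RS + L PQ*L QR*L RS + L PS*L QR*L RS + L PQ*L QS*L RS + L PR*L QS*L RS
     + L QR*L QS*L RS"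

text \<open>
  Kirchhoff's formula: the numerator lists the complements of the spanning forests with two
  components that separate the end points of \<open>e\<close>. Such a complement contains \<open>e\<close>, and without \<open>e\<close>
  it is the complement of the spanning tree obtained by adding \<open>e\<close> to the forest.
\<close>
definition edge_resistance :: "(tetra_edge \<Rightarrow> real) \<Rightarrow> tetra_edge \<Rightarrow> real" where
  "edge_resistance L e = L e * tree_poly (L(e := 0)) / tree_poly L"

fun tetra_resistance :: "(tetra_edge \<Rightarrow> real) \<Rightarrow> tetra_vertex \<Rightarrow> tetra_vertex \<Rightarrow> real" where
  "tetra_resistance L VP VP = 0"
| "tetra_resistance L VQ VQ = 0"
| "tetra_resistance L VR VR = 0"
| "tetra_resistance L VS VS = 0"
| "tetra_resistance L VP VQ = edge_resistance L PQ"
| "tetra_resistance L VQ VP = edge_resistance L PQ"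
| "tetra_resistance L VP VR = edge_resistance L PR"
| "tetra_resistance L VR VP = edge_resistance L PR"
| "tetra_resistance L VP VS = edge_resistance L PS"
| "tetra_resistance L VS VP = edge_resistance L PS"
| "tetra_resistance L VQ VR = edge_resistance L QR"
| "tetra_resistance L VR VQ = edge_resistance L QR"
| "tetra_resistance L VQ VS = edge_resistance L QS"
| "tetra_resistance L VS VQ = edge_resistance L QS"
| "tetra_resistance L VR VS = edge_resistance L RS"
| "tetra_resistance L VS VR = edge_resistance L RS"

text \<open>
  The masses are forced by the case \<open>p = q\<close> of the equation \<open>laplacian_r\<close>.
\<close>
definition tetra_weight :: "(tetra_edge \<Rightarrow> real) \<Rightarrow> tetra_vertex \<Rightarrow> real" where
  "tetra_weight L v = 1 - (\<Sum>e\<in>out_arcs tetrahedral_graph v \<union> in_arcs tetrahedral_graph v.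
     tree_poly (L(e := 0)) / tree_poly L) / 2"

lemma tree_poly_pos:
  assumes "\<And>e. 0 < L e"
  shows "0 < tree_poly L"
  unfolding tree_poly_def by (intro add_pos_pos mult_pos_pos assms)

lemma resistance_matrix_tetra:
  assumes L: "\<And>e. 0 < L e"
  shows "resistance_matrix tetrahedral_graph L (tetra_resistance L) (tetra_weight L)"
proof -
  interpret T: fin_digraph tetrahedral_graph by (rule fin_digraph_tetra)
  have T: "tree_poly L \<noteq> 0" and ne: "L e \<noteq> 0" for e using tree_poly_pos[of L, OF L] L[of e] by auto
  show ?thesis
  proof
    show "tetra_resistance L p p' = tetra_resistance L p' p" for p p'
      by (cases p; cases p'; simp)
    show "tetra_resistance L p p = 0" for p by (cases p) simp_all
    fix p p' :: tetra_vertex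
    show "laplacian tetrahedral_graph L (tetra_resistance L p') p =
        2 * tetra_weight L p - (if p = p' then 2 else 0)"
      by (cases p; cases p'; simp add: laplacian_def tetra_weight_def out_arcs_tetra in_arcs_tetra
          edge_resistance_def T ne divide_simps; simp add: tree_poly_def algebra_simps)
  qed (rule L)
qed


lemma tetra_resistance_ends: "tetra_resistance L (tetra_tail e) (tetra_head e) = edge_resistance L e"
  by (cases e) simp_all

lemma tree_poly_less:
  assumes L: "\<And>e. 0 < L e"
  shows "tree_poly (L(e := 0)) < tree_poly L"
proof -
  have "0 < L PQ" "0 < L PR" "0 < L PS" "0 < L QR" "0 < L QS" "0 < L RS" using L by auto
  then show ?thesis
    by (cases e; simp add: tree_poly_def; intro add_pos_pos add_strict_mono mult_pos_pos; assumption?)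
qed

lemma edge_resistance_less:
  assumes L: "\<And>e. 0 < L e"
  shows "edge_resistance L e < L e"
  using tree_poly_pos[of L, OF L] tree_poly_less[of L e, OF L] L[of e]
  by (simp add: edge_resistance_def divide_less_eq)

lemma bridgeless_polarized_tetra:
  assumes L: "\<And>e. 0 < L e"
  shows "bridgeless_polarized tetrahedral_graph L (tetra_resistance L) (tetra_weight L) (\<lambda>_. 0)"
proof -
  interpret resistance_matrix tetrahedral_graph L "tetra_resistance L" "tetra_weight L"
    by (rule resistance_matrix_tetra[OF L])
  show ?thesis
    by unfold_locales
      (auto simp: canonical_coeff_tetra genus_tetra connected_tetra_del_arc tetra_resistance_ends
        edge_resistance_less L)
qed


text \<open>
  The letters \<open>ma\<close> to \<open>mf\<close> are the partial derivatives of \<open>C\<close>, so that \<open>ma / C\<close> is the density on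
  the edge of length \<open>a\<close>, and \<open>c * (C - c*mc) / C\<close> is the resistance between \<open>P\<close> and \<open>S\<close>. The
  identity is the formula for the tau constant multiplied by \<open>12 * C\<^sup>2\<close>: the
  summand with the factor \<open>3\<close> is \<open>6 * C\<^sup>2 * rho\<close>, with \<open>rho\<close> evaluated at the vertex \<open>S\<close>.
\<close>
lemma tau_polynomial_identity:
  fixes a b c d e f :: real
  assumes "C = a*b*d + a*c*d + b*c*d + a*b*e + a*c*e + b*c*e + b*d*e + c*d*e + a*b*f + a*c*f
              + b*c*f + a*d*f + c*d*f + a*e*f + b*e*f + d*e*f"
  and "A = a*b*c*d + a*b*c*e + a*b*d*e + a*c*d*e + a*b*c*f + a*b*d*f + b*c*d*f + a*c*e*f
              + b*c*e*f + a*d*e*f + b*d*e*f + c*d*e*f"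
  and "B = b*c*d*e + a*c*d*f + a*b*e*f"
  and "ma = b*d + c*d + b*e + c*e + b*f + c*f + d*f + e*f"
  and "mb = a*d + c*d + a*e + c*e + d*e + a*f + c*f + e*f"
  and "mc = a*d + b*d + a*e + b*e + d*e + a*f + b*f + d*f"
  and "md = a*b + a*c + b*c + b*e + c*e + a*f + c*f + e*f"
  and "me = a*b + a*c + b*c + b*d + c*d + a*f + b*f + d*f"
  and "mf = a*b + a*c + b*c + a*d + c*d + a*e + b*e + d*e"
  shows "3 * ((a*ma + b*mb + c*mc - C) * (c * (C - c*mc)) + (a*ma + d*md + e*me - C) * (e * (C - e*me)) +
       (b*mb + d*md + f*mf - C) * (f * (C - f*mf)))
     + (a^3*ma^2 + b^3*mb^2 + c^3*mc^2 + d^3*md^2 + e^3*me^2 + f^3*mf^2) =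
     (a+b+c+d+e+f)*C^2 - 2*(A+2*B)*C"
  unfolding assms by algebra

lemma tau_const_tetra:
  fixes a b c d e f :: real
  assumes pos: "0 < a" "0 < b" "0 < c" "0 < d" "0 < e" "0 < f"
    and L: "L = tetra_length a b c d e f"
    and A: "A = a*b*c*d + a*b*c*e + a*b*d*e + a*c*d*e + a*b*c*f + a*b*d*f + b*c*d*f + a*c*e*f
              + b*c*e*f + a*d*e*f + b*d*e*f + c*d*e*f"
    and B: "B = b*c*d*e + a*c*d*f + a*b*e*f"
    and C: "C = a*b*d + a*c*d + b*c*d + a*b*e + a*c*e + b*c*e + b*d*e + c*d*e + a*b*f + a*c*f
              + b*c*f + a*d*f + c*d*f + a*e*f + b*e*f + d*e*f"
    and y: "y \<in> points tetrahedral_graph L"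
  shows "tau_const tetrahedral_graph L y = (a + b + c + d + e + f) / 12 - (A + 2 * B) / (6 * C)"
proof -
  have Lpos: "0 < L e" for e using pos by (cases e) (simp_all add: L)
  interpret bridgeless_polarized tetrahedral_graph L "tetra_resistance L" "tetra_weight L" "\<lambda>_. 0"
    by (rule bridgeless_polarized_tetra[OF Lpos])
  define ma where ma: "ma = b*d + c*d + b*e + c*e + b*f + c*f + d*f + e*f"
  define mb where mb: "mb = a*d + c*d + a*e + c*e + d*e + a*f + c*f + e*f"
  define mc where mc: "mc = a*d + b*d + a*e + b*e + d*e + a*f + b*f + d*f"
  define md where md: "md = a*b + a*c + b*c + b*e + c*e + a*f + c*f + e*f"
  define me where me: "me = a*b + a*c + b*c + b*d + c*d + a*f + b*f + d*f"
  define mf where mf: "mf = a*b + a*c + b*c + a*d + c*d + a*e + b*e + d*e"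
  have len: "L PQ = a" "L PR = b" "L PS = c" "L QR = d" "L QS = e" "L RS = f" by (simp_all add: L)
  have T: "tree_poly L = C" by (simp add: tree_poly_def len C)
  have C0: "0 < C" using tree_poly_pos[of L, OF Lpos] T by simp
  have T0: "tree_poly (L(PQ := 0)) = C - a*ma" "tree_poly (L(PR := 0)) = C - b*mb"
    "tree_poly (L(PS := 0)) = C - c*mc" "tree_poly (L(QR := 0)) = C - d*md"
    "tree_poly (L(QS := 0)) = C - e*me" "tree_poly (L(RS := 0)) = C - f*mf"
    by (simp_all add: tree_poly_def L C ma mb mc md me mf algebra_simps)
  have R: "edge_resistance L PQ = a * (C - a*ma) / C" "edge_resistance L PR = b * (C - b*mb) / C"
    "edge_resistance L PS = c * (C - c*mc) / C" "edge_resistance L QR = d * (C - d*md) / C"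
    "edge_resistance L QS = e * (C - e*me) / C" "edge_resistance L RS = f * (C - f*mf) / C"
    unfolding edge_resistance_def T T0 by (simp_all add: L)
  have k: "(x - x * (C - x * m) / C) / x\<^sup>2 = m / C" if "0 < x" for x m
    using that C0 by (simp add: divide_simps power2_eq_square) (simp add: algebra_simps)
  have kappa: "kappa PQ = ma / C" "kappa PR = mb / C" "kappa PS = mc / C"
    "kappa QR = md / C" "kappa QS = me / C" "kappa RS = mf / C"
    unfolding kappa_def tetra_simps tetra_resistance_ends R using pos by (simp_all add: L k)
  have w: "1 - ((C - x) / C + (C - y) / C + (C - z) / C) / 2 = (x + y + z - C) / (2 * C)" for x y z
    using C0 by (simp add: divide_simps)
  have weight: "tetra_weight L VP = (a*ma + b*mb + c*mc - C) / (2 * C)"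
    "tetra_weight L VQ = (a*ma + d*md + e*me - C) / (2 * C)"
    "tetra_weight L VR = (b*mb + d*md + f*mf - C) / (2 * C)"
    unfolding tetra_weight_def out_arcs_tetra in_arcs_tetra T w[symmetric]
    by (simp_all add: T0)
  have rho: "rho = ((a*ma + b*mb + c*mc - C) * (c * (C - c*mc)) + (a*ma + d*md + e*me - C) * (e * (C - e*me)) +
       (b*mb + d*md + f*mf - C) * (f * (C - f*mf))) / (2 * C\<^sup>2)"
    using sum_c_r[of VS]
    by (simp add: UNIV_tetra_vertex weight R power2_eq_square add_divide_distrib)
  have diagonal_energy: "diagonal_energy = (a^3*ma^2 + b^3*mb^2 + c^3*mc^2 + d^3*md^2 + e^3*me^2 + f^3*mf^2) / C\<^sup>2"
    by (simp add: diagonal_energy_def UNIV_tetra_edge kappa len power_divide add_divide_distrib mult.commute)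
  have "rho / 2 + diagonal_energy / 12 = ((a+b+c+d+e+f)*C^2 - 2*(A+2*B)*C) / (12 * C\<^sup>2)"
    unfolding rho diagonal_energy tau_polynomial_identity[OF C A B ma mb mc md me mf, symmetric]
    using C0 by (simp add: divide_simps) 
  also have "\<dots> = (a + b + c + d + e + f) / 12 - (A + 2 * B) / (6 * C)"
    using C0 by (simp add: divide_simps power2_eq_square) (simp add: algebra_simps)
  finally show ?thesis using tau_const_eq[OF y] by simp
qed

lemma theta_inv_tetra:
  fixes a b c d e f :: real
  assumes pos: "0 < a" "0 < b" "0 < c" "0 < d" "0 < e" "0 < f"
    and L: "L = tetra_length a b c d e f"
    and A: "A = a*b*c*d + a*b*c*e + a*b*d*e + a*c*d*e + a*b*c*f + a*b*d*f + b*c*d*f + a*c*e*f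
              + b*c*e*f + a*d*e*f + b*d*e*f + c*d*e*f"
    and B: "B = b*c*d*e + a*c*d*f + a*b*e*f"
    and C: "C = a*b*d + a*c*d + b*c*d + a*b*e + a*c*e + b*c*e + b*d*e + c*d*e + a*b*f + a*c*f
              + b*c*f + a*d*f + c*d*f + a*e*f + b*e*f + d*e*f"
  shows "theta_inv tetrahedral_graph L (\<lambda>_. 0) = (6 * A + 8 * B) / C"
proof -
  have Lpos: "0 < L e" for e using pos by (cases e) (simp_all add: L)
  interpret bridgeless_polarized tetrahedral_graph L "tetra_resistance L" "tetra_weight L" "\<lambda>_. 0"
    by (rule bridgeless_polarized_tetra[OF Lpos])
  have T: "tree_poly L = C" by (simp add: tree_poly_def L C)
  have "theta_inv tetrahedral_graph L (\<lambda>_. 0) =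
      2 * (edge_resistance L PQ + edge_resistance L PR + edge_resistance L PS +
        edge_resistance L QR + edge_resistance L QS + edge_resistance L RS)"
    by (simp add: theta_inv_def canonical_coeff_tetra resistance_vertices UNIV_tetra_vertex)
  also have "\<dots> = 2 * (a * tree_poly (L(PQ := 0)) + b * tree_poly (L(PR := 0)) + c * tree_poly (L(PS := 0)) +
      d * tree_poly (L(QR := 0)) + e * tree_poly (L(QS := 0)) + f * tree_poly (L(RS := 0))) / C"
    unfolding edge_resistance_def T by (simp add: L add_divide_distrib)
  also have "\<dots> = (6 * A + 8 * B) / C"
    by (rule arg_cong[where f = "\<lambda>x. x / C"]) (simp add: tree_poly_def L A B algebra_simps)
  finally show ?thesis .
qed

theorem mainTheorem5:
  fixes a b c d e f :: real and A B C l :: real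
    and L :: "tetra_edge \<Rightarrow> real" and q :: "tetra_vertex \<Rightarrow> nat"
  assumes pos: "0 < a" "0 < b" "0 < c" "0 < d" "0 < e" "0 < f"
    and L: "L = tetra_length a b c d e f"
    and q: "q = (\<lambda>_. 0)"
    and l: "l = total_length tetrahedral_graph L"
    and A: "A = a*b*c*d + a*b*c*e + a*b*d*e + a*c*d*e + a*b*c*f + a*b*d*f + b*c*d*f + a*c*e*f
              + b*c*e*f + a*d*e*f + b*d*e*f + c*d*e*f"
    and B: "B = b*c*d*e + a*c*d*f + a*b*e*f"
    and C: "C = a*b*d + a*c*d + b*c*d + a*b*e + a*c*e + b*c*e + b*d*e + c*d*e + a*b*f + a*c*f
              + b*c*f + a*d*f + c*d*f + a*e*f + b*e*f + d*e*f"
  shows "polarized_metrized_graph tetrahedral_graph L q \<and>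
    genus tetrahedral_graph q = 3 \<and>
    l = a + b + c + d + e + f \<and>
    delta_inv tetrahedral_graph L q 0 = l \<and>
    delta_inv tetrahedral_graph L q 1 = 0 \<and>
    (\<forall>y\<in>points tetrahedral_graph L.
       tau_const tetrahedral_graph L y = l / 12 - (A + 2 * B) / (6 * C)) \<and>
    theta_inv tetrahedral_graph L q = (6 * A + 8 * B) / C \<and>
    phi_inv tetrahedral_graph L q = l / 9 - (2 * A + 7 * B) / (9 * C) \<and>
    lambda_inv tetrahedral_graph L q = 3 * l / 28 + A / (28 * C) \<and>
    epsilon_inv tetrahedral_graph L q = 2 / 9 * l + (5 * A + 4 * B) / (9 * C)"
proof -
  let ?G = tetrahedral_graph
  have Lpos: "0 < L e" for e using pos by (cases e) (simp_all add: L)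
  interpret bridgeless_polarized tetrahedral_graph L "tetra_resistance L" "tetra_weight L" q
    unfolding q by (rule bridgeless_polarized_tetra[OF Lpos])
  have C0: "C \<noteq> 0" using tree_poly_pos[of L, OF Lpos] by (simp add: tree_poly_def L C)
  have l_sum: "l = a + b + c + d + e + f"
    by (simp add: l total_length_def UNIV_tetra_edge L)
  have g: "g = 3" by (simp add: q genus_tetra)
  have tau: "tau_const ?G L y = l / 12 - (A + 2 * B) / (6 * C)" if "y \<in> points ?G L" for y
    using tau_const_tetra[OF pos L A B C that] by (simp only: l_sum)
  have theta: "theta_inv ?G L q = (6 * A + 8 * B) / C"
    unfolding q by (rule theta_inv_tetra[OF pos L A B C])
  have P: "Vertex VP \<in> points ?G L" by (simp add: points_def)
  have eps: "epsilon_inv ?G L q = 2 / 9 * l + (5 * A + 4 * B) / (9 * C)"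
    unfolding epsilon_inv_eq[OF P] tau[OF P] theta g using C0
    by (simp add: divide_simps)
  have Z: "Z_inv ?G L q = ((6 * A + 8 * B) / C / 4 + 10 * (l / 12 - (A + 2 * B) / (6 * C))) / 18"
    unfolding Z_inv_eq[OF P] tau[OF P] theta g by simp
  have phi: "phi_inv ?G L q = l / 9 - (2 * A + 7 * B) / (9 * C)"
    unfolding phi_inv_def Z eps g l[symmetric] using C0
    by (simp add: divide_simps)
  have lambda: "lambda_inv ?G L q = 3 * l / 28 + A / (28 * C)"
    unfolding lambda_inv_def phi eps g l[symmetric] using C0
    by (simp add: divide_simps)
  have "polarized_metrized_graph ?G L q"
    using fin_digraph_tetra canonical_nonneg Lpos connected_del_arc_imp[OF connected_tetra_del_arc]
    by (simp add: polarized_metrized_graph_def metrized_graph_def)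
  then show ?thesis
    using delta_inv_0[OF connected_del_arc, of q] delta_inv_pos[OF connected_del_arc, of 1 q]
      l l_sum tau theta phi lambda eps
    by (simp add: q genus_tetra)
qed

end
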